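(* Let $\bar\varrho\in\mathscr{P}_2(\mathbb{R})$ and $\bar v\in L^2(\mathbb{R},\bar\varrho)$. Let $\mu\in\mathscr{P}_2(\mathbb{R})$ be a reference measure for which there exists a monotone transport map $\bar X\in\mathcal{C}$ with $\bar X\#\mu=\bar\varrho$ (such a map is unique as an element of $L^2(\mathbb{R},\mu)$), where $\mathcal{C}\subset L^2(\mathbb{R},\mu)$ is the closed convex cone of monotone maps. Define $$ \bar V:=\bar v\circ\bar X,\qquad X_t:=\mathsf{P}_{\mathcal{C}}(\bar X+t\bar V)\quad\text{for all }t\in\mathbb{R}. $$ Then the map $t\mapsto X_t\in L^2(\mathbb{R},\mu)$ is differentiable for a.e. $t\in\mathbb{R}$, and for a.e. $t$ the derivative $V_t:=\dot X_t$ can be written as $V_t=v_t\circ X_t$ for some velocity $v_t\in L^2(\mathbb{R},\varrho_t)$, where $\varrho_t:=X_t\#\mu$. Moreover, the pair $(\varrho_t,v_t)$ is a weak solution of the pressureless gas dynamics equations $$ \partial_t\varrho+\partial_x(\varrho v)=0,\qquad \partial_t(\varrho v)+\partial_x(\varrho v^2)=0\qquad\text{in }[0,\infty)\times\mathbb{R} $$ with initial data $(\bar\varrho,\bar v)$.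
   Context: $\mathscr{P}_2(\mathbb{R})$ is the set of Borel probability measures on $\mathbb{R}$ with finite second moment; $\#$ denotes push-forward of measures. For $\mu\in\mathscr{P}_2(\mathbb{R})$ and $X\in L^2(\mathbb{R},\mu)$ put $\gamma_X:=(\mathrm{id},X)\#\mu$, a Borel probability measure on $\mathbb{R}\times\mathbb{R}$. A set $\Gamma\subset\mathbb{R}\times\mathbb{R}$ is monotone if $(m_1-m_2)(x_1-x_2)\geq 0$ for all $(m_1,x_1),(m_2,x_2)\in\Gamma$. The map $X$ is called monotone if the support $\mathrm{spt}\,\gamma_X$ (the set of points all of whose open neighborhoods have positive $\gamma_X$-measure) is a monotone set. $\mathcal{C}:=\{X\in L^2(\mathbb{R},\mu): X\text{ is monotone}\}$, which is a closed convex cone, and $\mathsf{P}_{\mathcal{C}}:L^2(\mathbb{R},\mu)\to\mathcal{C}$ is the metric projection: $\mathsf{P}_{\mathcal{C}}(Y)$ is the unique element of $\mathcal{C}$ closest to $Y$ in the $L^2(\mathbb{R},\mu)$-norm. Differentiability of $t\mapsto X_t$ is with respect to the $L^2(\mathbb{R},\mu)$-norm. That $(\varrho_t,v_t)$ is a weak solution with initial data $(\bar\varrho,\bar v)$ means that for all $\varphi,\zeta\in\mathscr{D}([0,\infty)\times\mathbb{R})$ (smooth functions with compact support in $[0,\infty)\times\mathbb{R}$, not necessarily vanishing at $t=0$), $$ -\int_{\mathbb{R}}\varphi(0,x)\,\bar\varrho(dx)=\int_0^\infty\int_{\mathbb{R}}\big(\partial_t\varphi(t,x)+v_t(x)\,\partial_x\varphi(t,x)\big)\,\varrho_t(dx)\,dt,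 $$ $$ -\int_{\mathbb{R}}\zeta(0,x)\,\bar v(x)\,\bar\varrho(dx)=\int_0^\infty\int_{\mathbb{R}}\big(\partial_t\zeta(t,x)+v_t(x)\,\partial_x\zeta(t,x)\big)\,v_t(x)\,\varrho_t(dx)\,dt. $$ *)

theory Defs
  imports "HOL-Probability.Probability"
begin

definition P2 :: "real measure set" where
  "P2 = {M. prob_space M \<and> sets M = sets borel \<and> integrable M (\<lambda>x. x\<^sup>2)}"

text \<open>
  \<open>L2 M\<close> consists of functions, not of equivalence classes; equality in $L^2(M)$ is
  equality \<open>M\<close>-almost everywhere, which is the same as \<open>L2_norm M (\<lambda>x. f x - g x) = 0\<close>.
\<close>

definition L2 :: "'a measure \<Rightarrow> ('a \<Rightarrow> real) set" where
  "L2 M = {f. f \<in> borel_measurable M \<and> integrable M (\<lambda>x. (f x)\<^sup>2)}"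

definition L2_norm :: "'a measure \<Rightarrow> ('a \<Rightarrow> real) \<Rightarrow> real" where
  "L2_norm M f = sqrt (\<integral>x. (f x)\<^sup>2 \<partial>M)"

definition has_L2_derivative ::
    "'a measure \<Rightarrow> (real \<Rightarrow> 'a \<Rightarrow> real) \<Rightarrow> ('a \<Rightarrow> real) \<Rightarrow> real \<Rightarrow> bool" where
  "has_L2_derivative M X V t \<longleftrightarrow>
     V \<in> L2 M \<and>
     ((\<lambda>h. L2_norm M (\<lambda>m. (X (t + h) m - X t m) / h - V m)) \<longlongrightarrow> 0) (at 0)"

definition spt :: "'a::topological_space measure \<Rightarrow> 'a set" where
  "spt M = {z. \<forall>U. open U \<and> z \<in> U \<longrightarrow> emeasure M U > 0}"

definition monotone_set :: "(real \<times> real) set \<Rightarrow> bool" where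
  "monotone_set \<Gamma> \<longleftrightarrow>
     (\<forall>(m1, x1)\<in>\<Gamma>. \<forall>(m2, x2)\<in>\<Gamma>. (m1 - m2) * (x1 - x2) \<ge> 0)"

definition graph_measure :: "real measure \<Rightarrow> (real \<Rightarrow> real) \<Rightarrow> (real \<times> real) measure" where
  "graph_measure \<mu> X = distr \<mu> borel (\<lambda>m. (m, X m))"

definition monotone_maps :: "real measure \<Rightarrow> (real \<Rightarrow> real) set" where
  "monotone_maps \<mu> = {X \<in> L2 \<mu>. monotone_set (spt (graph_measure \<mu> X))}"

text \<open>
  A representative of the metric projection of \<open>Y\<close> onto the cone of monotone maps.
  It is determined only up to \<open>\<mu>\<close>-null sets; \<^const>\<open>arg_min_on\<close> selects one.
\<close>

definition proj_monotone :: "real measure \<Rightarrow> (real \<Rightarrow> real) \<Rightarrow> real \<Rightarrow> real" where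
  "proj_monotone \<mu> Y = arg_min_on (\<lambda>X. L2_norm \<mu> (\<lambda>m. Y m - X m)) (monotone_maps \<mu>)"

text \<open>
  All derivatives are taken within \<open>S\<close>. For the closed half-plane this means one-sided time
  derivatives on the boundary, so that smoothness up to the boundary is required, while the values
  outside \<open>S\<close> are irrelevant. Here \<open>f1\<close> and \<open>f2\<close> are the two partial derivatives of \<open>f\<close>.
\<close>

primrec Ck_on :: "nat \<Rightarrow> (real \<times> real) set \<Rightarrow> (real \<times> real \<Rightarrow> real) \<Rightarrow> bool" where
  "Ck_on 0 S f \<longleftrightarrow> continuous_on S f"
| "Ck_on (Suc k) S f \<longleftrightarrow>
     (\<exists>f1 f2. (\<forall>z\<in>S. (f has_derivative (\<lambda>h. f1 z * fst h + f2 z * snd h)) (at z within S)) \<and>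
              Ck_on k S f1 \<and> Ck_on k S f2)"

abbreviation half_plane :: "(real \<times> real) set" where
  "half_plane \<equiv> {0..} \<times> UNIV"

definition test_functions :: "(real \<times> real \<Rightarrow> real) set" where
  "test_functions =
     {\<phi>. (\<forall>k. Ck_on k half_plane \<phi>) \<and> compact (closure {z \<in> half_plane. \<phi> z \<noteq> 0})}"

definition deriv_t :: "(real \<times> real \<Rightarrow> real) \<Rightarrow> real \<Rightarrow> real \<Rightarrow> real" where
  "deriv_t \<phi> t x = vector_derivative (\<lambda>s. \<phi> (s, x)) (at t within {0..})"

definition deriv_x :: "(real \<times> real \<Rightarrow> real) \<Rightarrow> real \<Rightarrow> real \<Rightarrow> real" where
  "deriv_x \<phi> t x = deriv (\<lambda>y. \<phi> (t, y)) x"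

text \<open>
  Weak form of $\partial_t(\varrho w) + \partial_x(\varrho w v) = 0$ in $[0,\infty)\times\mathbb{R}$
  with initial value $\varrho_0 w_0$. The integrability conditions
  are stated explicitly because the Bochner integral of a non-integrable function is 0.
  Time integrals are taken with respect to \<^const>\<open>lebesgue\<close>, the completion of
  \<^const>\<open>lborel\<close>, since \<open>\<rho> t\<close>, \<open>v t\<close> and \<open>w t\<close> matter only for almost every \<open>t\<close>.
\<close>

definition weak_transport ::
    "(real \<Rightarrow> real measure) \<Rightarrow> (real \<Rightarrow> real \<Rightarrow> real) \<Rightarrow> (real \<Rightarrow> real \<Rightarrow> real) \<Rightarrow>
     real measure \<Rightarrow> (real \<Rightarrow> real) \<Rightarrow> bool" where
  "weak_transport \<rho> v w \<rho>0 w0 \<longleftrightarrow>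
     (\<forall>\<phi>\<in>test_functions.
        (AE t in lebesgue. t \<ge> 0 \<longrightarrow>
           integrable (\<rho> t) (\<lambda>x. (deriv_t \<phi> t x + v t x * deriv_x \<phi> t x) * w t x)) \<and>
        set_integrable lebesgue {0..}
          (\<lambda>t. \<integral>x. (deriv_t \<phi> t x + v t x * deriv_x \<phi> t x) * w t x \<partial>\<rho> t) \<and>
        - (\<integral>x. \<phi> (0, x) * w0 x \<partial>\<rho>0) =
          (LINT t:{0..}|lebesgue.
             (\<integral>x. (deriv_t \<phi> t x + v t x * deriv_x \<phi> t x) * w t x \<partial>\<rho> t)))"

definition pressureless_weak_solution ::
    "(real \<Rightarrow> real measure) \<Rightarrow> (real \<Rightarrow> real \<Rightarrow> real) \<Rightarrow> real measure \<Rightarrow> (real \<Rightarrow> real) \<Rightarrow> bool" where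
  "pressureless_weak_solution \<rho> v \<rho>0 v0 \<longleftrightarrow>
     weak_transport \<rho> v (\<lambda>t x. 1) \<rho>0 (\<lambda>x. 1) \<and>
     weak_transport \<rho> v v \<rho>0 v0"

end

theory Submission
  imports Defs
begin

text \<open>
  Write \<open>H = L\<^sup>2(\<mu>)\<close>, \<open>C\<close> for the cone of monotone maps and \<open>Y\<^sub>t = X\<^sub>0 + t V\<^sub>0\<close>, so that
  \<open>X\<^sub>t\<close> is the projection of \<open>Y\<^sub>t\<close> on \<open>C\<close>. Everything rests on conditional expectations
  \<open>E\<^sub>t = E[\<cdot> | X\<^sub>t]\<close>, the orthogonal projections of \<open>H\<close> on the space of functions of \<open>X\<^sub>t\<close>.

  The residual \<open>Y\<^sub>t - X\<^sub>t\<close> lies in the polar cone of \<open>C\<close> (\<open>closest_cone_polar\<close>), and it is orthogonal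
  to every function of \<open>X\<^sub>t\<close> (\<open>closest_monotone_orthogonal\<close>): for a Lipschitz function \<open>f\<close> and
  small \<open>\<epsilon>\<close> both \<open>X\<^sub>t + \<epsilon> f(X\<^sub>t)\<close> and \<open>X\<^sub>t - \<epsilon> f(X\<^sub>t)\<close> are monotone whenever \<open>f\<close> is nondecreasing.

  The flow is sticky (\<open>sticky\<close>): for \<open>0 < s < t\<close> the map \<open>X\<^sub>t\<close> is a function of \<open>X\<^sub>s\<close>.
  Indeed \<open>Y\<^sub>t = (t/s) Y\<^sub>s - (t/s - 1) X\<^sub>0\<close>. Replacing \<open>X\<^sub>t\<close> by \<open>W = E\<^sub>s X\<^sub>t\<close>, which is again monotone
  (\<open>is_cexp_mono\<close>), does not decrease the pairing with \<open>Y\<^sub>s\<close> because of the two properties of the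
  residual, and does not increase the pairing with \<open>X\<^sub>0\<close> by a conditional Chebyshev inequality
  (\<open>is_cexp_Chebyshev\<close>). Hence it does not decrease the pairing with \<open>Y\<^sub>t\<close>, while it decreases
  the norm unless \<open>W = X\<^sub>t\<close>; by minimality \<open>W = X\<^sub>t\<close>.

  Put \<open>V\<^sub>t = E\<^sub>t V\<^sub>0\<close>. By stickiness the ranges of the projections \<open>E\<^sub>t\<close> decrease in \<open>t > 0\<close>, so
  \<open>V\<^sub>t\<close> is a reverse martingale and its energy \<open>\<parallel>V\<^sub>t\<parallel>\<^sup>2\<close> is nonincreasing. A computation with inner
  products shows that the difference quotient of \<open>X\<close> between \<open>s\<close> and \<open>t\<close> is at squared distance at most
  \<open>\<parallel>V\<^sub>s\<parallel>\<^sup>2 - \<parallel>V\<^sub>t\<parallel>\<^sup>2\<close> from both \<open>V\<^sub>s\<close> and \<open>V\<^sub>t\<close> (\<open>difference_quotient_bounds\<close>). Hence \<open>X\<close> has the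
  derivative \<open>V\<^sub>t\<close> at every \<open>t > 0\<close> where the energy is continuous, that is, off a countable set.
  Negative times follow by reversing \<open>V\<^sub>0\<close>. By construction \<open>V\<^sub>t = v\<^sub>t \<circ> X\<^sub>t\<close>.

  For a test function \<open>\<phi>\<close> and \<open>U\<close> in \<open>H\<close> the function \<open>t \<mapsto> \<integral> \<phi>(t, X\<^sub>t) U d\<mu>\<close> is Lipschitz and
  can be differentiated off a countable set; integrating its derivative from \<open>0\<close> to \<open>\<infinity>\<close>
  gives the continuity equation for \<open>U = 1\<close>. For \<open>U = V\<^sub>0\<close> it gives the momentum equation, because
  \<open>\<partial>\<^sub>t\<phi>(t, X\<^sub>t) + V\<^sub>t \<partial>\<^sub>x\<phi>(t, X\<^sub>t)\<close> is a function of \<open>X\<^sub>t\<close>, and so has the same pairing with \<open>V\<^sub>0\<close>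
  as with \<open>V\<^sub>t\<close>.
\<close>

section \<open>Square-integrable functions\<close>

lemma L2_measurable: "f \<in> L2 M \<Longrightarrow> f \<in> borel_measurable M"
  and L2_square_integrable: "f \<in> L2 M \<Longrightarrow> integrable M (\<lambda>x. (f x)\<^sup>2)"
  by (simp_all add: L2_def)

lemma L2_mult_integrable:
  assumes "f \<in> L2 M" "g \<in> L2 M"
  shows "integrable M (\<lambda>x. f x * g x)"
proof (rule Bochner_Integration.integrable_bound)
  show "integrable M (\<lambda>x. (f x)\<^sup>2 + (g x)\<^sup>2)"
    using assms by (simp add: L2_def)
  show "(\<lambda>x. f x * g x) \<in> borel_measurable M"
    using assms by (auto simp: L2_def)
  have "\<bar>a * b\<bar> \<le> a\<^sup>2 + b\<^sup>2" for a b :: real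
    using sum_squares_bound[of "\<bar>a\<bar>" "\<bar>b\<bar>"] mult_nonneg_nonneg[OF abs_ge_zero[of a] abs_ge_zero[of b]]
    by (simp only: abs_mult power2_abs)
  then show "AE x in M. norm (f x * g x) \<le> norm ((f x)\<^sup>2 + (g x)\<^sup>2)"
    by simp
qed

lemma L2_add:
  assumes "f \<in> L2 M" "g \<in> L2 M"
  shows "(\<lambda>x. f x + g x) \<in> L2 M"
  using assms L2_mult_integrable[OF assms] by (auto simp: L2_def power2_sum mult.assoc)

lemma L2_diff:
  assumes "f \<in> L2 M" "g \<in> L2 M"
  shows "(\<lambda>x. f x - g x) \<in> L2 M"
  using assms L2_mult_integrable[OF assms] by (auto simp: L2_def power2_diff mult.assoc)

lemma L2_scale: "f \<in> L2 M \<Longrightarrow> (\<lambda>x. c * f x) \<in> L2 M"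
  by (auto simp: L2_def power_mult_distrib)

lemma L2_uminus: "f \<in> L2 M \<Longrightarrow> (\<lambda>x. - f x) \<in> L2 M"
  by (auto simp: L2_def)

lemma L2_divide: "f \<in> L2 M \<Longrightarrow> (\<lambda>x. f x / c) \<in> L2 M"
  using L2_scale[of f M "1 / c"] by simp

lemma L2_dominated:
  assumes "f \<in> L2 M" "g \<in> borel_measurable M" "AE x in M. \<bar>g x\<bar> \<le> c * \<bar>f x\<bar>"
  shows "g \<in> L2 M"
proof -
  have "integrable M (\<lambda>x. (g x)\<^sup>2)"
  proof (rule Bochner_Integration.integrable_bound)
    show "integrable M (\<lambda>x. c\<^sup>2 * (f x)\<^sup>2)" using assms(1) by (simp add: L2_def)
    show "(\<lambda>x. (g x)\<^sup>2) \<in> borel_measurable M" using assms(2) by simp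
    have "b\<^sup>2 \<le> c\<^sup>2 * a\<^sup>2" if "\<bar>b\<bar> \<le> c * \<bar>a\<bar>" for a b :: real
      using power_mono[OF that, of 2] by (simp add: power_mult_distrib)
    then show "AE x in M. norm ((g x)\<^sup>2) \<le> norm (c\<^sup>2 * (f x)\<^sup>2)"
      using assms(3) by auto
  qed
  then show ?thesis using assms(2) by (auto simp: L2_def)
qed

lemma L2_cong_AE:
  assumes "f \<in> L2 M" "g \<in> borel_measurable M" "AE x in M. g x = f x"
  shows "g \<in> L2 M"
  by (rule L2_dominated[OF assms(1,2), of 1]) (use assms(3) in auto)

lemma L2_const: "finite_measure M \<Longrightarrow> (\<lambda>x. c) \<in> L2 M"
  by (simp add: L2_def finite_measure.integrable_const)

lemma L2_bounded:
  assumes "finite_measure M" "f \<in> borel_measurable M" "\<And>x. \<bar>f x\<bar> \<le> B"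
  shows "f \<in> L2 M"
  by (rule L2_dominated[OF L2_const[OF assms(1), of 1] assms(2), of B]) (use assms(3) in auto)

lemma L2_integrable:
  assumes "finite_measure M" "f \<in> L2 M"
  shows "integrable M f"
  using L2_mult_integrable[OF assms(2) L2_const[OF assms(1), of 1]] by simp

lemmas L2_intros = L2_add L2_diff L2_scale L2_uminus L2_divide

definition ip :: "'a measure \<Rightarrow> ('a \<Rightarrow> real) \<Rightarrow> ('a \<Rightarrow> real) \<Rightarrow> real" where
  "ip M f g = (\<integral>x. f x * g x \<partial>M)"

lemma ip_commute: "ip M f g = ip M g f"
  by (simp add: ip_def mult.commute)

lemma ip_left:
  assumes "f \<in> L2 M" "h \<in> L2 M"
  shows ip_add_left: "g \<in> L2 M \<Longrightarrow> ip M (\<lambda>x. f x + g x) h = ip M f h + ip M g h"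
    and ip_diff_left: "g \<in> L2 M \<Longrightarrow> ip M (\<lambda>x. f x - g x) h = ip M f h - ip M g h"
    and ip_scale_left: "ip M (\<lambda>x. c * f x) h = c * ip M f h"
    and ip_divide_left: "ip M (\<lambda>x. f x / c) h = ip M f h / c"
    and ip_uminus_left: "ip M (\<lambda>x. - f x) h = - ip M f h"
  using assms by (simp_all add: ip_def distrib_right left_diff_distrib mult.assoc L2_mult_integrable)

lemma ip_right:
  assumes "f \<in> L2 M" "h \<in> L2 M"
  shows ip_add_right: "g \<in> L2 M \<Longrightarrow> ip M h (\<lambda>x. f x + g x) = ip M h f + ip M h g"
    and ip_diff_right: "g \<in> L2 M \<Longrightarrow> ip M h (\<lambda>x. f x - g x) = ip M h f - ip M h g"
    and ip_scale_right: "ip M h (\<lambda>x. c * f x) = c * ip M h f"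
    and ip_divide_right: "ip M h (\<lambda>x. f x / c) = ip M h f / c"
    and ip_uminus_right: "ip M h (\<lambda>x. - f x) = - ip M h f"
  using ip_left[OF assms] by (simp_all add: ip_commute[of M h])

lemmas ip_linear = ip_left ip_right L2_intros

lemma ip_cong_AE:
  assumes "AE x in M. f x = f' x" "AE x in M. g x = g' x"
    "f \<in> borel_measurable M" "f' \<in> borel_measurable M" "g \<in> borel_measurable M" "g' \<in> borel_measurable M"
  shows "ip M f g = ip M f' g'"
  unfolding ip_def by (rule integral_cong_AE) (use assms in auto)

lemma ip_self_nonneg: "0 \<le> ip M f f"
  by (simp add: ip_def)

lemma L2_norm_ip: "L2_norm M f = sqrt (ip M f f)"
  by (simp add: L2_norm_def ip_def power2_eq_square)

lemma L2_norm_nonneg: "0 \<le> L2_norm M f"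
  by (simp add: L2_norm_def)

lemma L2_norm_square: "(L2_norm M f)\<^sup>2 = ip M f f"
  by (simp add: L2_norm_ip ip_self_nonneg)

lemma L2_norm_le_iff: "L2_norm M f \<le> L2_norm M g \<longleftrightarrow> ip M f f \<le> ip M g g"
  by (simp add: L2_norm_ip)

lemma ip_self_zero_AE:
  assumes "f \<in> L2 M" "ip M f f \<le> 0"
  shows "AE x in M. f x = 0"
proof -
  have "integrable M (\<lambda>x. f x * f x)" by (rule L2_mult_integrable[OF assms(1,1)])
  moreover have "(\<integral>x. f x * f x \<partial>M) = 0"
    using assms(2) ip_self_nonneg[of M f] unfolding ip_def by linarith
  ultimately have "AE x in M. f x * f x = 0"
    by (subst (asm) integral_nonneg_eq_0_iff_AE) auto
  then show ?thesis by simp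
qed

lemma ip_diff_scaled:
  assumes "f \<in> L2 M" "g \<in> L2 M"
  shows "ip M (\<lambda>x. f x - s * g x) (\<lambda>x. f x - s * g x)
    = ip M f f - 2 * s * ip M f g + s\<^sup>2 * ip M g g"
  using assms by (simp add: ip_linear ip_commute[of M g f] power2_eq_square algebra_simps)

lemma ip_Cauchy_Schwarz:
  assumes "f \<in> L2 M" "g \<in> L2 M"
  shows "\<bar>ip M f g\<bar> \<le> L2_norm M f * L2_norm M g"
proof -
  let ?a = "ip M f f" and ?b = "ip M f g" and ?c = "ip M g g"
  have quad: "0 \<le> ?a - 2 * s * ?b + s\<^sup>2 * ?c" for s
    using ip_self_nonneg[of M "\<lambda>x. f x - s * g x"] by (simp add: ip_diff_scaled assms)
  have "?b\<^sup>2 \<le> ?a * ?c"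
  proof (cases "?c = 0")
    case True
    then have "0 \<le> ?a - 2 * s * ?b" for s using quad[of s] by simp
    from this[of "(?a + 1) / (2 * ?b)"] have "?b = 0" by (cases "?b = 0") auto
    then show ?thesis using True by simp
  next
    case False
    then have "?c > 0" using ip_self_nonneg[of M g] by simp
    then show ?thesis using quad[of "?b / ?c"]
      by (simp add: field_simps power2_eq_square)
  qed
  then have "sqrt (?b\<^sup>2) \<le> sqrt (?a * ?c)" by (rule real_sqrt_le_mono)
  then show ?thesis by (simp add: L2_norm_ip real_sqrt_mult)
qed

lemma L2_norm_triangle:
  assumes "f \<in> L2 M" "g \<in> L2 M"
  shows "L2_norm M (\<lambda>x. f x + g x) \<le> L2_norm M f + L2_norm M g"
proof (rule power2_le_imp_le)
  have "(L2_norm M (\<lambda>x. f x + g x))\<^sup>2 = (L2_norm M f)\<^sup>2 + 2 * ip M f g + (L2_norm M g)\<^sup>2"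
    using assms by (simp add: L2_norm_square ip_linear ip_commute[of M g f])
  then show "(L2_norm M (\<lambda>x. f x + g x))\<^sup>2 \<le> (L2_norm M f + L2_norm M g)\<^sup>2"
    using ip_Cauchy_Schwarz[OF assms] by (simp add: power2_sum)
qed (simp add: L2_norm_nonneg)

lemma L2_norm_mono:
  assumes "f \<in> borel_measurable M" "g \<in> L2 M" "\<And>x. \<bar>f x\<bar> \<le> \<bar>g x\<bar>"
  shows "L2_norm M f \<le> L2_norm M g"
proof -
  have "f \<in> L2 M" by (rule L2_dominated[OF assms(2,1), of 1]) (use assms(3) in simp)
  then have "(\<integral>x. (f x)\<^sup>2 \<partial>M) \<le> (\<integral>x. (g x)\<^sup>2 \<partial>M)"
    using assms by (intro integral_mono L2_square_integrable) (auto simp: abs_le_square_iff)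
  then show ?thesis by (simp add: L2_norm_def)
qed

lemma L2_norm_scale: "L2_norm M (\<lambda>x. c * f x) = \<bar>c\<bar> * L2_norm M f"
  by (simp add: L2_norm_def power_mult_distrib real_sqrt_mult)

lemma L2_abs: "f \<in> L2 M \<Longrightarrow> (\<lambda>x. \<bar>f x\<bar>) \<in> L2 M"
  by (auto simp: L2_def)

lemma L2_norm_abs: "L2_norm M (\<lambda>x. \<bar>f x\<bar>) = L2_norm M f"
  by (simp add: L2_norm_def)

lemma L2_distr:
  assumes "g \<in> borel_measurable M" "f \<in> borel_measurable borel"
  shows "f \<in> L2 (distr M borel g) \<longleftrightarrow> (\<lambda>m. f (g m)) \<in> L2 M"
  using assms by (auto simp: L2_def integrable_distr_eq intro: measurable_compose)

section \<open>Metric projections\<close>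

text \<open>
  Closedness of \<open>K\<close> is asked for in the form of stability under almost everywhere limits. A minimizing
  sequence whose errors decay geometrically converges almost everywhere, and Fatou's lemma shows
  that its limit attains the infimum.
\<close>
lemma L2_projection_exists:
  assumes K: "K \<subseteq> L2 M" "K \<noteq> {}" and Y: "Y \<in> L2 M"
    and midpoint: "\<And>f g. f \<in> K \<Longrightarrow> g \<in> K \<Longrightarrow> (\<lambda>x. (f x + g x) / 2) \<in> K"
    and closed: "\<And>u f. (\<And>n::nat. u n \<in> K) \<Longrightarrow> f \<in> L2 M \<Longrightarrow>
        (AE x in M. (\<lambda>n. u n x) \<longlonglongrightarrow> f x) \<Longrightarrow> f \<in> K"
  shows "\<exists>p\<in>K. \<forall>g\<in>K. L2_norm M (\<lambda>x. Y x - p x) \<le> L2_norm M (\<lambda>x. Y x - g x)"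
proof -
  define J where "J g = ip M (\<lambda>x. Y x - g x) (\<lambda>x. Y x - g x)" for g
  define d where "d = (INF g\<in>K. J g)"
  have bdd: "bdd_below (J ` K)"
    by (rule bdd_belowI[of _ 0]) (auto simp: J_def ip_self_nonneg)
  have d_le: "d \<le> J g" if "g \<in> K" for g
    unfolding d_def by (rule cINF_lower[OF bdd that])
  have "\<exists>g\<in>K. J g < d + (1/16)^n" for n :: nat
    using cINF_less_iff[OF K(2) bdd, of "d + (1/16)^n"] by (simp add: d_def)
  then obtain u where u: "\<And>n. u n \<in> K" "\<And>n. J (u n) < d + (1/16)^n" by metis
  have uL2: "u n \<in> L2 M" for n using u(1) K(1) by blast
  note [measurable] = L2_measurable[OF uL2] L2_measurable[OF Y]
  \<comment> \<open>The parallelogram law makes the minimizing sequence Cauchy, with a geometric rate.\<close>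
  have cauchy: "ip M (\<lambda>x. u (Suc n) x - u n x) (\<lambda>x. u (Suc n) x - u n x) \<le> 4 * (1/16)^n" for n
  proof -
    let ?mid = "\<lambda>x. (u (Suc n) x + u n x) / 2"
    have "ip M (\<lambda>x. u (Suc n) x - u n x) (\<lambda>x. u (Suc n) x - u n x)
        = 2 * J (u (Suc n)) + 2 * J (u n) - 4 * J ?mid"
      unfolding J_def using Y uL2[of n] uL2[of "Suc n"]
      by (simp add: ip_linear ip_commute algebra_simps add_divide_distrib diff_divide_distrib)
    moreover have "d \<le> J ?mid" by (intro d_le midpoint u)
    moreover have "(0::real) \<le> (1/16)^n" by simp
    ultimately show ?thesis using u(2)[of n] u(2)[of "Suc n"]
      unfolding power_Suc by linarith
  qed
  \<comment> \<open>The weights \<open>4\<^sup>n\<close> keep the sum finite and still force increments below \<open>2\<^sup>-\<^sup>n\<close> pointwise.\<close>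
  have conv: "AE x in M. convergent (\<lambda>n. u n x)"
  proof -
    have "(\<integral>\<^sup>+x. (\<Sum>n. ennreal (4^n * (u (Suc n) x - u n x)\<^sup>2)) \<partial>M) \<noteq> \<infinity>"
    proof -
      have "(\<integral>\<^sup>+x. (\<Sum>n. ennreal (4^n * (u (Suc n) x - u n x)\<^sup>2)) \<partial>M)
          = (\<Sum>n. \<integral>\<^sup>+x. ennreal (4^n * (u (Suc n) x - u n x)\<^sup>2) \<partial>M)"
        by (rule nn_integral_suminf) simp
      also have "\<dots> \<le> (\<Sum>n. ennreal (4 * (1/4)^n))"
      proof (intro suminf_le allI summableI)
        fix n
        have "(\<integral>\<^sup>+x. ennreal (4^n * (u (Suc n) x - u n x)\<^sup>2) \<partial>M)
            = ennreal (\<integral>x. 4^n * (u (Suc n) x - u n x)\<^sup>2 \<partial>M)"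
          using L2_square_integrable[OF L2_diff[OF uL2 uL2]]
          by (intro nn_integral_eq_integral) auto
        also have "(\<integral>x. 4^n * (u (Suc n) x - u n x)\<^sup>2 \<partial>M) \<le> 4^n * (4 * (1/16)^n)"
          using cauchy[of n] by (simp add: ip_def power2_eq_square)
        also have "(4::real)^n * (4 * (1/16)^n) = 4 * (1/4)^n"
        proof -
          have "(4::real)^n * (1/16)^n = (1/4)^n" by (subst power_mult_distrib[symmetric]) simp
          then show ?thesis by simp
        qed
        finally show "(\<integral>\<^sup>+x. ennreal (4^n * (u (Suc n) x - u n x)\<^sup>2) \<partial>M) \<le> ennreal (4 * (1/4)^n)"
          by (simp add: ennreal_leI)
      qed
      also have "\<dots> = ennreal (\<Sum>n. 4 * (1/4)^n)"
        by (intro suminf_ennreal2 summable_mult summable_geometric) auto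
      finally show ?thesis by (auto simp: top_unique)
    qed
    then have "AE x in M. (\<Sum>n. ennreal (4^n * (u (Suc n) x - u n x)\<^sup>2)) \<noteq> \<infinity>"
      by (intro nn_integral_noteq_infinite) auto
    then show ?thesis
    proof eventually_elim
      case (elim x)
      then have "summable (\<lambda>n. 4^n * (u (Suc n) x - u n x)\<^sup>2)"
        by (intro summable_suminf_not_top) auto
      then have "(\<lambda>n. 4^n * (u (Suc n) x - u n x)\<^sup>2) \<longlonglongrightarrow> 0"
        by (rule summable_LIMSEQ_zero)
      then have "\<forall>\<^sub>F n in sequentially. 4^n * (u (Suc n) x - u n x)\<^sup>2 < 1"
        by (rule order_tendstoD) simp
      then have "\<forall>\<^sub>F n in sequentially. norm (u (Suc n) x - u n x) \<le> (1/2)^n"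
      proof eventually_elim
        case (elim n)
        have "(2^n * (u (Suc n) x - u n x))\<^sup>2 = 4^n * (u (Suc n) x - u n x)\<^sup>2"
        proof -
          have "((2::real)^n)\<^sup>2 = 4^n" by (simp add: power2_eq_square flip: power_mult_distrib)
          then show ?thesis by (simp only: power_mult_distrib)
        qed
        then have "(2^n * (u (Suc n) x - u n x))\<^sup>2 \<le> 1" using elim by simp
        then have "\<bar>2^n * (u (Suc n) x - u n x)\<bar> \<le> 1"
          by (simp only: abs_square_le_1)
        then have "2^n * \<bar>u (Suc n) x - u n x\<bar> \<le> 1"
          unfolding abs_mult by simp
        then show ?case by (simp add: power_divide pos_le_divide_eq mult.commute)
      qed
      then have "summable (\<lambda>n. u (Suc n) x - u n x)"
        by (rule summable_comparison_test_ev) (simp add: summable_geometric)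
      then have "convergent (\<lambda>n. \<Sum>i<n. u (Suc i) x - u i x)"
        by (simp only: summable_iff_convergent)
      moreover have "(\<lambda>n. \<Sum>i<n. u (Suc i) x - u i x) = (\<lambda>n. u n x - u 0 x)"
        by (intro ext sum_lessThan_telescope)
      ultimately have "convergent (\<lambda>n. u n x - u 0 x)" by (simp only:)
      from convergent_add[OF this convergent_const[of "u 0 x"]] show ?case by simp
    qed
  qed
  define p where "p x = lim (\<lambda>n. u n x)" for x
  have p_meas [measurable]: "p \<in> borel_measurable M"
    unfolding p_def by (rule borel_measurable_lim_metric) simp
  have to_p: "AE x in M. (\<lambda>n. u n x) \<longlonglongrightarrow> p x"
    using conv unfolding p_def by (simp add: convergent_LIMSEQ_iff)
  have d_nonneg: "0 \<le> d"
    unfolding d_def by (rule cINF_greatest[OF K(2)]) (simp add: J_def ip_self_nonneg)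
  have fatou: "(\<integral>\<^sup>+x. ennreal ((Y x - p x)\<^sup>2) \<partial>M) \<le> ennreal d"
  proof -
    have "(\<integral>\<^sup>+x. ennreal ((Y x - p x)\<^sup>2) \<partial>M)
        = (\<integral>\<^sup>+x. liminf (\<lambda>n. ennreal ((Y x - u n x)\<^sup>2)) \<partial>M)"
    proof (rule nn_integral_cong_AE, use to_p in eventually_elim)
      case (elim x)
      then have "(\<lambda>n. ennreal ((Y x - u n x)\<^sup>2)) \<longlonglongrightarrow> ennreal ((Y x - p x)\<^sup>2)"
        by (intro tendsto_ennrealI tendsto_intros)
      from lim_imp_Liminf[OF _ this] show ?case by simp
    qed
    also have "\<dots> \<le> liminf (\<lambda>n. \<integral>\<^sup>+x. ennreal ((Y x - u n x)\<^sup>2) \<partial>M)"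
      by (rule nn_integral_liminf) simp
    also have "\<dots> \<le> liminf (\<lambda>n. ennreal (d + (1/16)^n))"
    proof (intro Liminf_mono always_eventually allI)
      fix n
      have "(\<integral>\<^sup>+x. ennreal ((Y x - u n x)\<^sup>2) \<partial>M) = ennreal (J (u n))"
        unfolding J_def ip_def power2_eq_square[symmetric]
        using L2_square_integrable[OF L2_diff[OF Y uL2]]
        by (intro nn_integral_eq_integral) auto
      then show "(\<integral>\<^sup>+x. ennreal ((Y x - u n x)\<^sup>2) \<partial>M) \<le> ennreal (d + (1/16)^n)"
        using u(2)[of n] by (simp add: ennreal_leI)
    qed
    also have "\<dots> = ennreal d"
    proof (rule lim_imp_Liminf)
      have "(\<lambda>n. d + (1/16)^n) \<longlonglongrightarrow> d + 0"
        by (intro tendsto_intros LIMSEQ_realpow_zero) auto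
      then show "(\<lambda>n. ennreal (d + (1/16)^n)) \<longlonglongrightarrow> ennreal d"
        by (intro tendsto_ennrealI) simp
    qed simp
    finally show ?thesis .
  qed
  have int: "integrable M (\<lambda>x. (Y x - p x)\<^sup>2)"
    by (rule integrableI_bounded) (use fatou in \<open>auto simp: top_unique intro: le_less_trans\<close>)
  then have "(\<lambda>x. Y x - p x) \<in> L2 M" by (simp add: L2_def)
  from L2_diff[OF Y this] have "p \<in> L2 M" by simp
  then have "p \<in> K" using closed[OF u(1) _ to_p] by simp
  moreover have "J p \<le> d"
  proof -
    have "ennreal (J p) = (\<integral>\<^sup>+x. ennreal ((Y x - p x)\<^sup>2) \<partial>M)"
      unfolding J_def ip_def power2_eq_square[symmetric] using int
      by (intro nn_integral_eq_integral[symmetric]) auto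
    with fatou have "ennreal (J p) \<le> ennreal d" by simp
    then show ?thesis using d_nonneg by (simp only: ennreal_le_iff)
  qed
  ultimately show ?thesis
    using d_le order_trans unfolding L2_norm_le_iff J_def by blast
qed

definition closest :: "'a measure \<Rightarrow> ('a \<Rightarrow> real) set \<Rightarrow> ('a \<Rightarrow> real) \<Rightarrow> ('a \<Rightarrow> real) \<Rightarrow> bool" where
  "closest M K Y p \<longleftrightarrow>
     p \<in> K \<and> (\<forall>g\<in>K. L2_norm M (\<lambda>x. Y x - p x) \<le> L2_norm M (\<lambda>x. Y x - g x))"

text \<open>
  If \<open>p\<close> may be moved a little in the direction \<open>g\<close> without leaving \<open>K\<close>, the squared distance to \<open>Y\<close>
  has a nonnegative derivative in that direction. The bound \<open>\<delta>\<close> on the steps makes room for directions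
  that are admissible only for short steps.
\<close>
lemma closest_first_variation:
  assumes p: "closest M K Y p" "p \<in> L2 M" and Y: "Y \<in> L2 M" and g: "g \<in> L2 M"
    and \<delta>: "0 < \<delta>" "\<And>\<epsilon>. 0 < \<epsilon> \<Longrightarrow> \<epsilon> < \<delta> \<Longrightarrow> (\<lambda>x. p x + \<epsilon> * g x) \<in> K"
  shows "ip M (\<lambda>x. Y x - p x) g \<le> 0"
proof (rule ccontr)
  let ?N = "\<lambda>x. Y x - p x"
  let ?b = "ip M ?N g" and ?c = "ip M g g"
  assume "\<not> ?b \<le> 0"
  then have b: "?b > 0" by simp
  have N: "?N \<in> L2 M" using p(2) Y by (simp add: L2_diff)
  have ineq: "2 * \<epsilon> * ?b \<le> \<epsilon>\<^sup>2 * ?c" if "0 < \<epsilon>" "\<epsilon> < \<delta>" for \<epsilon>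
  proof -
    have "ip M ?N ?N \<le> ip M (\<lambda>x. Y x - (p x + \<epsilon> * g x)) (\<lambda>x. Y x - (p x + \<epsilon> * g x))"
      using p(1) \<delta>(2)[OF that] by (simp add: closest_def L2_norm_le_iff)
    also have "\<dots> = ip M (\<lambda>x. ?N x - \<epsilon> * g x) (\<lambda>x. ?N x - \<epsilon> * g x)"
      by (simp add: algebra_simps)
    also have "\<dots> = ip M ?N ?N - 2 * \<epsilon> * ?b + \<epsilon>\<^sup>2 * ?c"
      by (rule ip_diff_scaled[OF N g])
    finally show ?thesis by simp
  qed
  have c: "0 \<le> ?c" by (rule ip_self_nonneg)
  \<comment> \<open>A step this small makes the quadratic term at most half of the linear one;
    \<open>?c + 1\<close> avoids a division by zero.\<close>
  define \<epsilon> where "\<epsilon> = min (\<delta>/2) (?b / (?c + 1))"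
  have \<epsilon>: "0 < \<epsilon>" "\<epsilon> < \<delta>" using \<delta>(1) b c by (auto simp: \<epsilon>_def min_less_iff_disj)
  have "\<epsilon> * ?c \<le> \<epsilon> * (?c + 1)" using \<epsilon> by simp
  also have "\<dots> \<le> ?b / (?c + 1) * (?c + 1)"
    by (rule mult_right_mono) (use c in \<open>auto simp: \<epsilon>_def\<close>)
  also have "\<dots> = ?b" using c by simp
  finally have "\<epsilon> * (\<epsilon> * ?c) \<le> \<epsilon> * ?b" using \<epsilon>(1) by simp
  moreover have "\<epsilon> * ?b > 0" using \<epsilon>(1) b by simp
  ultimately show False using ineq[OF \<epsilon>] by (simp add: power2_eq_square)
qed

lemma closest_cone_polar:
  assumes p: "closest M K Y p" and K: "K \<subseteq> L2 M" and Y: "Y \<in> L2 M"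
    and add: "\<And>f g. f \<in> K \<Longrightarrow> g \<in> K \<Longrightarrow> (\<lambda>x. f x + g x) \<in> K"
    and scale: "\<And>c f. 0 \<le> c \<Longrightarrow> f \<in> K \<Longrightarrow> (\<lambda>x. c * f x) \<in> K"
    and g: "g \<in> K"
  shows "ip M (\<lambda>x. Y x - p x) g \<le> 0"
proof (rule closest_first_variation[OF p _ Y _ zero_less_one])
  have pK: "p \<in> K" using p by (simp add: closest_def)
  then show "p \<in> L2 M" "g \<in> L2 M" using g K by blast+
  show "(\<lambda>x. p x + \<epsilon> * g x) \<in> K" if "0 < \<epsilon>" for \<epsilon>
    using that by (intro add[OF pK] scale g) simp
qed

section \<open>Monotone maps\<close>

text \<open>
  The condition on \<open>A\<close> means that \<open>A\<close> contains a measurable set of full measure.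
\<close>
definition mono_AE :: "real measure \<Rightarrow> (real \<Rightarrow> real) \<Rightarrow> bool" where
  "mono_AE \<mu> X \<longleftrightarrow> (\<exists>A. (AE m in \<mu>. m \<in> A) \<and> mono_on A X)"

lemma mono_AE_I: "AE m in \<mu>. m \<in> A \<Longrightarrow> mono_on A X \<Longrightarrow> mono_AE \<mu> X"
  unfolding mono_AE_def by (intro exI conjI)

lemma mono_AE_E:
  assumes "mono_AE \<mu> X"
  obtains A where "AE m in \<mu>. m \<in> A" "mono_on A X"
  using assms unfolding mono_AE_def by (elim exE conjE)

lemma closed_spt: "closed (spt M)"
proof -
  have "- spt M = \<Union>{U. open U \<and> \<not> emeasure M U > 0}"
    by (auto simp: spt_def)
  then have "open (- spt M)" by (auto intro: open_Union)
  then show ?thesis by (simp add: closed_open)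
qed

text \<open>
  The complement of the support is a union of open null sets, and countably many of them suffice by
  second countability.
\<close>
lemma AE_in_spt:
  fixes M :: "'a::second_countable_topology measure"
  assumes "sets M = sets borel"
  shows "AE z in M. z \<in> spt M"
proof -
  obtain B :: "'a set set" where B: "countable B" "topological_basis B"
    using ex_countable_basis by blast
  let ?B = "{U\<in>B. emeasure M U = 0}"
  have open_B: "open U" if "U \<in> B" for U using B(2) that by (rule topological_basis_open)
  have "\<Union>?B \<in> null_sets M"
    using B(1) assms open_B
    by (intro null_sets_UN'[of ?B "\<lambda>U. U", simplified]) (auto intro: countable_subset)
  moreover have "- spt M \<subseteq> \<Union>?B"
  proof
    fix z assume "z \<in> - spt M"
    then obtain U where U: "open U" "z \<in> U" "emeasure M U = 0" by (auto simp: spt_def)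
    then obtain V where V: "V \<in> B" "z \<in> V" "V \<subseteq> U"
      using topological_basisE[OF B(2)] by metis
    have "emeasure M V \<le> emeasure M U"
      using V U(1) assms open_B by (intro emeasure_mono) auto
    then show "z \<in> \<Union>?B" using U V by auto
  qed
  ultimately show ?thesis
    by (intro AE_I'[of "\<Union>?B"]) auto
qed

text \<open>
  Monotonicity of the support of the graph measure is monotonicity of the map off a null set: almost
  every point of the graph lies in the support, and every point of the support is a limit of points
  of the graph over any set of full measure.
\<close>
lemma monotone_maps_iff:
  assumes \<mu>: "sets \<mu> = sets borel"
  shows "X \<in> monotone_maps \<mu> \<longleftrightarrow> X \<in> L2 \<mu> \<and> mono_AE \<mu> X"
proof (cases "X \<in> L2 \<mu>")
  case True
  have [measurable]: "X \<in> borel_measurable \<mu>" by (rule L2_measurable[OF True])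
  have [measurable]: "(\<lambda>m. m) \<in> borel_measurable \<mu>"
    using measurable_ident_sets[OF \<mu>] by simp
  have graph [measurable]: "(\<lambda>m. (m, X m)) \<in> borel_measurable \<mu>"
    by (rule borel_measurable_Pair) simp_all
  let ?S = "spt (graph_measure \<mu> X)"
  have "mono_AE \<mu> X \<longleftrightarrow> monotone_set ?S"
  proof
    assume mono: "monotone_set ?S"
    have "AE z in graph_measure \<mu> X. z \<in> ?S"
      by (rule AE_in_spt) (simp add: graph_measure_def)
    then have "AE m in \<mu>. m \<in> {m. (m, X m) \<in> ?S}"
      unfolding graph_measure_def
      by (subst (asm) AE_distr_iff) (auto simp: graph intro!: borel_closed closed_spt)
    moreover have "mono_on {m. (m, X m) \<in> ?S} X"
    proof (rule mono_onI)
      fix m1 m2 assume *: "m1 \<in> {m. (m, X m) \<in> ?S}" "m2 \<in> {m. (m, X m) \<in> ?S}" "m1 \<le> m2"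
      show "X m1 \<le> X m2"
      proof (cases "m1 = m2")
        case False
        then have "m1 - m2 < 0" using * by simp
        moreover have "(m1 - m2) * (X m1 - X m2) \<ge> 0"
          using mono * unfolding monotone_set_def by blast
        ultimately show ?thesis by (auto simp: zero_le_mult_iff)
      qed simp
    qed
    ultimately show "mono_AE \<mu> X" by (rule mono_AE_I)
  next
    assume "mono_AE \<mu> X"
    then obtain A where A: "AE m in \<mu>. m \<in> A" "mono_on A X" by (rule mono_AE_E)
    have meets: "\<exists>m\<in>A. (m, X m) \<in> U" if "open U" "z \<in> U" "z \<in> ?S" for z U
    proof (rule ccontr)
      assume "\<not> ?thesis"
      then have "\<And>m. m \<in> A \<Longrightarrow> (m, X m) \<notin> U" by simp
      with A(1) have "AE m in \<mu>. (m, X m) \<notin> U" by (rule eventually_mono)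
      moreover have U: "U \<in> sets borel" using that(1) by simp
      ultimately have "AE z in graph_measure \<mu> X. z \<notin> U"
        unfolding graph_measure_def using borel_comp[OF U]
        by (subst AE_distr_iff) (auto simp: graph Compl_eq)
      then have "emeasure (graph_measure \<mu> X) U = 0"
        using U AE_iff_null_sets[of U "graph_measure \<mu> X"] by (auto simp: graph_measure_def)
      then show False using that by (auto simp: spt_def)
    qed
    \<comment> \<open>A decreasing pair of points of the support has disjoint box neighbourhoods, which
      would force a decreasing pair of points on the graph over \<open>A\<close>.\<close>
    have no_decrease: False
      if S: "(a1, b1) \<in> ?S" "(a2, b2) \<in> ?S" and less: "a1 < a2" "b2 < b1" for a1 a2 b1 b2
    proof -
      obtain a where a: "a1 < a" "a < a2" using less(1) dense by blast
      obtain b where b: "b2 < b" "b < b1" using less(2) dense by blast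
      obtain m1 where "m1 \<in> A" "(m1, X m1) \<in> {..<a} \<times> {b<..}"
        using meets[OF open_Times[OF open_lessThan open_greaterThan] _ S(1)] a b by auto
      moreover obtain m2 where "m2 \<in> A" "(m2, X m2) \<in> {a<..} \<times> {..<b}"
        using meets[OF open_Times[OF open_greaterThan open_lessThan] _ S(2)] a b by auto
      ultimately show False using mono_onD[OF A(2), of m1 m2] by auto
    qed
    show "monotone_set ?S"
      unfolding monotone_set_def
    proof (clarify)
      fix a1 b1 a2 b2 assume *: "(a1, b1) \<in> ?S" "(a2, b2) \<in> ?S"
      have "a1 < a2 \<Longrightarrow> b1 \<le> b2" "a2 < a1 \<Longrightarrow> b2 \<le> b1"
        using no_decrease[OF *] no_decrease[OF *(2,1)] by (meson not_le)+
      then show "0 \<le> (a1 - a2) * (b1 - b2)"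
        by (cases a1 a2 rule: linorder_cases) (auto simp: zero_le_mult_iff)
    qed
  qed
  then show ?thesis using True by (simp add: monotone_maps_def)
qed (simp add: monotone_maps_def)

lemma mono_AE_add:
  assumes "mono_AE \<mu> X" "mono_AE \<mu> Z"
  shows "mono_AE \<mu> (\<lambda>m. X m + Z m)"
proof -
  obtain A where A: "AE m in \<mu>. m \<in> A" "mono_on A X" using assms(1) by (rule mono_AE_E)
  obtain B where B: "AE m in \<mu>. m \<in> B" "mono_on B Z" using assms(2) by (rule mono_AE_E)
  have "AE m in \<mu>. m \<in> A \<inter> B" using A(1) B(1) by simp
  moreover have "mono_on (A \<inter> B) (\<lambda>m. X m + Z m)"
    using A(2) B(2) by (auto simp: mono_on_def intro: add_mono)
  ultimately show ?thesis by (rule mono_AE_I)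
qed

lemma mono_AE_compose:
  assumes "mono_AE \<mu> X" "mono f"
  shows "mono_AE \<mu> (\<lambda>m. f (X m))"
proof -
  obtain A where A: "AE m in \<mu>. m \<in> A" "mono_on A X" using assms(1) by (rule mono_AE_E)
  have "mono_on A (\<lambda>m. f (X m))"
    using A(2) assms(2) by (auto simp: mono_on_def mono_def)
  with A(1) show ?thesis by (rule mono_AE_I)
qed

lemma mono_AE_limit:
  assumes "\<And>n::nat. mono_AE \<mu> (u n)" "AE m in \<mu>. (\<lambda>n. u n m) \<longlonglongrightarrow> X m"
  shows "mono_AE \<mu> X"
proof -
  obtain A where A: "\<And>n. AE m in \<mu>. m \<in> A n" "\<And>n. mono_on (A n) (u n)"
    using assms(1) unfolding mono_AE_def by metis
  let ?B = "(\<Inter>n. A n) \<inter> {m. (\<lambda>n. u n m) \<longlonglongrightarrow> X m}"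
  have "AE m in \<mu>. \<forall>n. m \<in> A n" using A(1) by (simp add: AE_all_countable)
  then have "AE m in \<mu>. m \<in> ?B" using assms(2) by eventually_elim auto
  moreover have "mono_on ?B X"
  proof (rule mono_onI)
    fix a b assume *: "a \<in> ?B" "b \<in> ?B" "a \<le> b"
    then have "u n a \<le> u n b" for n using A(2)[of n] by (auto simp: mono_on_def)
    then show "X a \<le> X b" using * by (auto intro: LIMSEQ_le)
  qed
  ultimately show ?thesis by (rule mono_AE_I)
qed

lemma monotone_maps_add:
  assumes "sets \<mu> = sets borel" "X \<in> monotone_maps \<mu>" "Z \<in> monotone_maps \<mu>"
  shows "(\<lambda>m. X m + Z m) \<in> monotone_maps \<mu>"
  using assms by (simp add: monotone_maps_iff L2_add mono_AE_add)

lemma monotone_maps_scale: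
  assumes "sets \<mu> = sets borel" "0 \<le> c" "X \<in> monotone_maps \<mu>"
  shows "(\<lambda>m. c * X m) \<in> monotone_maps \<mu>"
  using assms mono_AE_compose[of \<mu> X "\<lambda>x. c * x"]
  by (simp add: monotone_maps_iff L2_scale mono_def mult_left_mono)

lemma monotone_maps_L2: "X \<in> monotone_maps \<mu> \<Longrightarrow> X \<in> L2 \<mu>"
  by (simp add: monotone_maps_def)

text \<open>
  A minimizer exists, so the choice operator in the definition of the projection yields one.
\<close>
lemma closest_proj_monotone:
  assumes \<mu>: "sets \<mu> = sets borel" and fin: "finite_measure \<mu>" and Y: "Y \<in> L2 \<mu>"
  shows "closest \<mu> (monotone_maps \<mu>) Y (proj_monotone \<mu> Y)"
proof -
  have "mono_AE \<mu> (\<lambda>m. 0)"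
    unfolding mono_AE_def by (rule exI[of _ UNIV]) (simp add: mono_on_def)
  then have nonempty: "monotone_maps \<mu> \<noteq> {}"
    using \<mu> L2_const[OF fin, of 0] by (auto simp: monotone_maps_iff)
  have "\<exists>p\<in>monotone_maps \<mu>. \<forall>g\<in>monotone_maps \<mu>.
      L2_norm \<mu> (\<lambda>x. Y x - p x) \<le> L2_norm \<mu> (\<lambda>x. Y x - g x)"
  proof (rule L2_projection_exists[OF _ nonempty Y])
    show "monotone_maps \<mu> \<subseteq> L2 \<mu>" by (auto simp: monotone_maps_L2)
    show "(\<lambda>x. (f x + g x) / 2) \<in> monotone_maps \<mu>"
      if "f \<in> monotone_maps \<mu>" "g \<in> monotone_maps \<mu>" for f g
      using monotone_maps_scale[OF \<mu> _ monotone_maps_add[OF \<mu> that], of "1/2"] by simp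
    show "f \<in> monotone_maps \<mu>"
      if "\<And>n::nat. u n \<in> monotone_maps \<mu>" "f \<in> L2 \<mu>" "AE x in \<mu>. (\<lambda>n. u n x) \<longlonglongrightarrow> f x" for u f
      using that \<mu> mono_AE_limit[of \<mu> u f] by (simp add: monotone_maps_iff)
  qed
  then obtain p where "is_arg_min (\<lambda>X. L2_norm \<mu> (\<lambda>m. Y m - X m)) (\<lambda>X. X \<in> monotone_maps \<mu>) p"
    by (auto simp: is_arg_min_linorder)
  then have "is_arg_min (\<lambda>X. L2_norm \<mu> (\<lambda>m. Y m - X m)) (\<lambda>X. X \<in> monotone_maps \<mu>)
      (proj_monotone \<mu> Y)"
    unfolding proj_monotone_def arg_min_on_def arg_min_def 
    by (rule someI[where P = "is_arg_min (\<lambda>X. L2_norm \<mu> (\<lambda>m. Y m - X m)) (\<lambda>X. X \<in> monotone_maps \<mu>)"])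
  then show ?thesis by (auto simp: closest_def is_arg_min_linorder)
qed

section \<open>Orthogonality of the residual\<close>

text \<open>
  The positive and negative parts of \<open>N\<close> are densities whose images under \<open>p\<close> agree on half-lines,
  hence on all Borel sets.
\<close>
lemma integral_composed_eq_0:
  assumes N: "integrable M N" and p [measurable]: "p \<in> borel_measurable M"
    and half: "\<And>a. (\<integral>x. N x * indicator {a<..} (p x) \<partial>M) = (0::real)"
    and \<phi> [measurable]: "\<phi> \<in> borel_measurable borel"
    and int: "integrable M (\<lambda>x. N x * \<phi> (p x))"
  shows "(\<integral>x. N x * \<phi> (p x :: real) \<partial>M) = 0"
proof -
  define P where "P = (\<lambda>x. max 0 (N x))"
  define Q where "Q = (\<lambda>x. max 0 (- N x))"
  have [measurable]: "N \<in> borel_measurable M" using N by simp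
  have PQ: "N x = P x - Q x" "0 \<le> P x" "0 \<le> Q x" "P x \<le> \<bar>N x\<bar>" "Q x \<le> \<bar>N x\<bar>" for x
    by (auto simp: P_def Q_def)
  have [measurable]: "P \<in> borel_measurable M" "Q \<in> borel_measurable M"
    by (simp_all add: P_def Q_def)
  have intPQ: "integrable M (\<lambda>x. P x * f x)" "integrable M (\<lambda>x. Q x * f x)"
    if [measurable]: "f \<in> borel_measurable M" and "integrable M (\<lambda>x. N x * f x)" for f
    by (rule Bochner_Integration.integrable_bound[OF that(2)],
        use PQ in \<open>auto simp: abs_mult intro!: mult_right_mono AE_I2\<close>)+
  define D where "D f = distr (density M (\<lambda>x. ennreal (f x))) borel p" for f :: "_ \<Rightarrow> real"
  have em: "emeasure (D f) {a<..} = ennreal (\<integral>x. f x * indicator {a<..} (p x) \<partial>M)"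
    if [measurable]: "f \<in> borel_measurable M" and f: "\<And>x. 0 \<le> f x"
      "integrable M (\<lambda>x. f x * indicator {a<..} (p x))" for f a
  proof -
    have "emeasure (D f) {a<..}
        = (\<integral>\<^sup>+x. ennreal (f x) * indicator (p -` {a<..} \<inter> space M) x \<partial>M)"
      unfolding D_def by (simp add: emeasure_distr emeasure_density)
    also have "\<dots> = (\<integral>\<^sup>+x. ennreal (f x * indicator {a<..} (p x)) \<partial>M)"
      by (intro nn_integral_cong) (auto simp: indicator_def)
    also have "\<dots> = ennreal (\<integral>x. f x * indicator {a<..} (p x) \<partial>M)"
      using f by (intro nn_integral_eq_integral) auto
    finally show ?thesis .
  qed
  have intN: "integrable M (\<lambda>x. N x * indicator {a<..} (p x))" for a
    by (rule Bochner_Integration.integrable_bound[OF N]) (auto simp: abs_mult indicator_def)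
  have intPi: "integrable M (\<lambda>x. P x * indicator {a<..} (p x))"
    and intQi: "integrable M (\<lambda>x. Q x * indicator {a<..} (p x))" for a
    by (rule intPQ[OF _ intN]; simp)+
  have "D P = D Q"
  proof (rule measure_eqI_lessThan)
    show "emeasure (D P) {a<..} < \<infinity>" for a
      by (simp add: em[OF _ PQ(2) intPi])
    have "(\<integral>x. P x * indicator {a<..} (p x) \<partial>M) - (\<integral>x. Q x * indicator {a<..} (p x) \<partial>M) = 0" for a
      using half[of a] intPi intQi
      by (subst (asm) PQ(1)) (simp add: left_diff_distrib)
    then show "emeasure (D P) {a<..} = emeasure (D Q) {a<..}" for a
      by (simp add: em[OF _ PQ(2) intPi] em[OF _ PQ(3) intQi])
  qed (simp_all add: D_def)
  moreover have "(\<integral>x. \<phi> x \<partial>D f) = (\<integral>x. f x * \<phi> (p x) \<partial>M)"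
    if [measurable]: "f \<in> borel_measurable M" and "\<And>x. 0 \<le> f x" for f
    unfolding D_def using that(2) by (subst integral_distr) (auto simp: integral_real_density)
  ultimately have "(\<integral>x. P x * \<phi> (p x) \<partial>M) = (\<integral>x. Q x * \<phi> (p x) \<partial>M)"
    using PQ by (metis \<open>P \<in> borel_measurable M\<close> \<open>Q \<in> borel_measurable M\<close>)
  then show ?thesis
    using intPQ[OF _ int] by (simp add: PQ(1) left_diff_distrib)
qed

text \<open>
  For nondecreasing \<open>f\<close> with Lipschitz constant \<open>L\<close> both \<open>id + \<epsilon> f\<close> and \<open>id - \<epsilon> f\<close> are
  nondecreasing when \<open>\<epsilon> \<le> 1/L\<close>, so \<open>p\<close> can be varied within the monotone maps in the directions \<open>f(p)\<close>
  and \<open>-f(p)\<close>. Piecewise linear \<open>f\<close> approximate the indicators of half-lines, which determine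
  everything else by the previous lemma.
\<close>
lemma closest_monotone_orthogonal:
  assumes \<mu>: "sets \<mu> = sets borel" and fin: "finite_measure \<mu>" and Y: "Y \<in> L2 \<mu>"
    and p: "closest \<mu> (monotone_maps \<mu>) Y p"
    and \<phi>: "\<phi> \<in> borel_measurable borel" "(\<lambda>m. \<phi> (p m)) \<in> L2 \<mu>"
  shows "ip \<mu> (\<lambda>m. Y m - p m) (\<lambda>m. \<phi> (p m)) = 0"
proof -
  let ?N = "\<lambda>m. Y m - p m"
  have p_mono: "p \<in> L2 \<mu>" "mono_AE \<mu> p"
    using p \<mu> by (auto simp: closest_def monotone_maps_iff)
  have N: "?N \<in> L2 \<mu>" by (rule L2_diff[OF Y p_mono(1)])
  note [measurable] = L2_measurable[OF p_mono(1)] L2_measurable[OF N]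
  have Lip: "ip \<mu> ?N (\<lambda>m. f (p m)) = 0"
    if f: "mono f" "\<And>x. \<bar>f x\<bar> \<le> B" "0 < L" "\<And>x y. x \<le> y \<Longrightarrow> f y - f x \<le> L * (y - x)" for f B L
  proof -
    have [measurable]: "f \<in> borel_measurable borel" by (rule borel_measurable_mono[OF f(1)])
    have fp: "(\<lambda>m. f (p m)) \<in> L2 \<mu>" by (rule L2_bounded[OF fin _ f(2)]) simp
    have up: "ip \<mu> ?N (\<lambda>m. f (p m)) \<le> 0"
    proof (rule closest_first_variation[OF p p_mono(1) Y fp zero_less_one])
      fix \<epsilon> :: real assume \<epsilon>: "0 < \<epsilon>" "\<epsilon> < 1"
      then have "mono_AE \<mu> (\<lambda>m. \<epsilon> * f (p m))"
        using f(1) by (intro mono_AE_compose[OF p_mono(2)]) (auto simp: mono_def)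
      then show "(\<lambda>m. p m + \<epsilon> * f (p m)) \<in> monotone_maps \<mu>"
        using \<mu> p_mono fp by (simp add: monotone_maps_iff mono_AE_add L2_add L2_scale)
    qed
    have "ip \<mu> ?N (\<lambda>m. - f (p m)) \<le> 0"
    proof (rule closest_first_variation[OF p p_mono(1) Y L2_uminus[OF fp], of "1 / L"])
      fix \<epsilon> :: real assume \<epsilon>: "0 < \<epsilon>" "\<epsilon> < 1 / L"
      \<comment> \<open>Steps below \<open>1 / L\<close> keep \<open>x - \<epsilon> f x\<close> nondecreasing.\<close>
      have "mono (\<lambda>x. x + \<epsilon> * - f x)"
      proof (rule monoI)
        fix x y :: real assume "x \<le> y"
        have "\<epsilon> * (f y - f x) \<le> \<epsilon> * (L * (y - x))"
          using \<epsilon> f(4)[OF \<open>x \<le> y\<close>] by (intro mult_left_mono) auto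
        also have "\<dots> = (\<epsilon> * L) * (y - x)" by simp
        also have "\<dots> \<le> 1 * (y - x)"
          using \<epsilon> f(3) \<open>x \<le> y\<close> by (intro mult_right_mono) (auto simp: field_simps)
        finally show "x + \<epsilon> * - f x \<le> y + \<epsilon> * - f y" by (simp add: algebra_simps)
      qed
      from mono_AE_compose[OF p_mono(2) this]
      show "(\<lambda>m. p m + \<epsilon> * - f (p m)) \<in> monotone_maps \<mu>"
        using \<mu> L2_add[OF p_mono(1) L2_scale[OF L2_uminus[OF fp]]] by (simp add: monotone_maps_iff)
    qed (use f in auto)
    then show ?thesis using up ip_uminus_right[OF fp N] by simp
  qed
  have half: "(\<integral>m. ?N m * indicator {a<..} (p m) \<partial>\<mu>) = 0" for a
  proof -
    define f where "f k x = min 1 (max 0 (real (Suc k) * (x - a)))" for k x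
    have mono_f: "mono (f k)" for k
      unfolding f_def by (intro monoI min.mono max.mono mult_left_mono) auto
    have [measurable]: "f k \<in> borel_measurable borel" for k by (rule borel_measurable_mono[OF mono_f])
    have zero: "ip \<mu> ?N (\<lambda>m. f k (p m)) = 0" for k
    proof (rule Lip[OF mono_f, of k 1 "real (Suc k)"])
      fix x y :: real assume "x \<le> y"
      then have "real (Suc k) * (x - a) \<le> real (Suc k) * (y - a)" by (intro mult_left_mono) auto
      moreover have "real (Suc k) * (y - x) = real (Suc k) * (y - a) - real (Suc k) * (x - a)"
        by (simp add: algebra_simps)
      ultimately show "f k y - f k x \<le> real (Suc k) * (y - x)" unfolding f_def by linarith
    qed (auto simp: f_def)
    have to_ind: "(\<lambda>k. f k x) \<longlonglongrightarrow> indicator {a<..} x" for x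
    proof (cases "a < x")
      case True
      have "filterlim (\<lambda>k. real (Suc k)) at_top sequentially"
        using filterlim_compose[OF filterlim_real_sequentially filterlim_Suc] .
      then have "\<forall>\<^sub>F k in sequentially. 1 / (x - a) \<le> real (Suc k)"
        by (simp only: filterlim_at_top)
      then have "\<forall>\<^sub>F k in sequentially. f k x = 1"
        by eventually_elim (use True in \<open>auto simp: f_def field_simps min_def max_def\<close>)
      then show ?thesis using True by (simp add: tendsto_eventually)
    next
      case False
      then have "real (Suc k) * (x - a) \<le> 0" for k by (intro mult_nonneg_nonpos) auto
      then have "f k x = 0" for k unfolding f_def by (simp only: max_absorb1 min_def) simp
      then show ?thesis using False by simp
    qed
    have "(\<lambda>k. \<integral>m. ?N m * f k (p m) \<partial>\<mu>) \<longlonglongrightarrow> (\<integral>m. ?N m * indicator {a<..} (p m) \<partial>\<mu>)"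
    proof (rule integral_dominated_convergence[where w = "\<lambda>m. \<bar>?N m\<bar>"])
      show "integrable \<mu> (\<lambda>m. \<bar>?N m\<bar>)" using L2_integrable[OF fin N] by simp
      show "AE m in \<mu>. (\<lambda>k. ?N m * f k (p m)) \<longlonglongrightarrow> ?N m * indicator {a<..} (p m)"
        by (intro AE_I2 tendsto_intros to_ind)
      have "\<bar>f k x\<bar> \<le> 1" for k x by (auto simp: f_def)
      then show "AE m in \<mu>. norm (?N m * f k (p m)) \<le> \<bar>?N m\<bar>" for k
        by (auto simp: abs_mult intro!: AE_I2 mult_left_le)
    qed simp_all
    then show ?thesis using zero by (simp add: ip_def LIMSEQ_const_iff)
  qed
  show ?thesis
    unfolding ip_def
    by (rule integral_composed_eq_0[OF L2_integrable[OF fin N] _ half \<phi>(1)])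
      (use L2_mult_integrable[OF N \<phi>(2)] in simp_all)
qed

section \<open>Conditional expectation given a map\<close>

text \<open>
  \<open>w \<circ> X\<close> is the conditional expectation of \<open>Z\<close> given \<open>X\<close>. Storing the Borel function \<open>w\<close> rather than
  the composite makes the factorization through \<open>X\<close> explicit.
\<close>
definition is_cexp ::
    "'a measure \<Rightarrow> ('a \<Rightarrow> real) \<Rightarrow> ('a \<Rightarrow> real) \<Rightarrow> (real \<Rightarrow> real) \<Rightarrow> bool" where
  "is_cexp M X Z w \<longleftrightarrow> w \<in> borel_measurable borel \<and> (\<lambda>m. w (X m)) \<in> L2 M \<and>
     (\<forall>\<phi>\<in>borel_measurable borel. (\<lambda>m. \<phi> (X m)) \<in> L2 M \<longrightarrow>
        ip M Z (\<lambda>m. \<phi> (X m)) = ip M (\<lambda>m. w (X m)) (\<lambda>m. \<phi> (X m)))"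

text \<open>
  The conditional expectation is the metric projection on the subspace of functions of \<open>X\<close>. The subspace
  is stable under almost everywhere limits, since the limit can be taken in the Borel
  functions on the line.
\<close>
lemma is_cexp_exists:
  assumes fin: "finite_measure M" and X [measurable]: "X \<in> borel_measurable M" and Z: "Z \<in> L2 M"
  shows "\<exists>w. is_cexp M X Z w"
proof -
  define K where "K = {f \<in> L2 M. \<exists>\<phi>\<in>borel_measurable borel. AE m in M. f m = \<phi> (X m)}"
  have K_L2: "K \<subseteq> L2 M" by (auto simp: K_def)
  have "\<exists>p\<in>K. \<forall>g\<in>K. L2_norm M (\<lambda>x. Z x - p x) \<le> L2_norm M (\<lambda>x. Z x - g x)"
  proof (rule L2_projection_exists[OF K_L2 _ Z])
    have "(\<lambda>m. 0) \<in> K"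
      using L2_const[OF fin, of 0] by (auto simp: K_def intro!: bexI[of _ "\<lambda>x. 0"])
    then show "K \<noteq> {}" by blast
  next
    fix f g assume "f \<in> K" "g \<in> K"
    then obtain \<phi> \<psi> where *: "f \<in> L2 M" "g \<in> L2 M"
      "\<phi> \<in> borel_measurable borel" "\<psi> \<in> borel_measurable borel"
      "AE m in M. f m = \<phi> (X m)" "AE m in M. g m = \<psi> (X m)"
      by (auto simp: K_def)
    have "AE m in M. (f m + g m) / 2 = (\<phi> (X m) + \<psi> (X m)) / 2"
      using *(5,6) by eventually_elim simp
    moreover have "(\<lambda>x. (\<phi> x + \<psi> x) / 2) \<in> borel_measurable borel" using *(3,4) by simp
    ultimately show "(\<lambda>x. (f x + g x) / 2) \<in> K"
      unfolding K_def using *(1,2)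
      by (auto intro!: L2_divide L2_add bexI[of _ "\<lambda>x. (\<phi> x + \<psi> x) / 2"])
  next
    fix u :: "nat \<Rightarrow> _" and f
    assume u: "\<And>n. u n \<in> K" and f: "f \<in> L2 M" and lim: "AE x in M. (\<lambda>n. u n x) \<longlonglongrightarrow> f x"
    have "\<exists>\<phi>\<in>borel_measurable borel. AE m in M. u n m = \<phi> (X m)" for n
      using u[of n] by (simp add: K_def)
    then obtain \<phi> where \<phi>: "\<And>n. \<phi> n \<in> borel_measurable borel" "\<And>n. AE m in M. u n m = \<phi> n (X m)"
      by metis
    (* The default value of lim, taken where the functions \<phi> n diverge, keeps the limit Borel. *)
    have "AE m in M. \<forall>n. u n m = \<phi> n (X m)" using \<phi>(2) by (simp add: AE_all_countable)
    then have "AE m in M. f m = lim (\<lambda>n. \<phi> n (X m))"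
      using lim by eventually_elim (simp add: limI)
    moreover have "(\<lambda>x. lim (\<lambda>n. \<phi> n x)) \<in> borel_measurable borel"
      by (rule borel_measurable_lim_metric[OF \<phi>(1)])
    ultimately show "f \<in> K"
      using f by (auto simp: K_def intro!: bexI[of _ "\<lambda>x. lim (\<lambda>n. \<phi> n x)"])
  qed
  then obtain p where p: "closest M K Z p" by (auto simp: closest_def)
  then have "p \<in> K" by (simp add: closest_def)
  then obtain w where pL2: "p \<in> L2 M" and w [measurable]: "w \<in> borel_measurable borel"
    and pw: "AE m in M. p m = w (X m)" by (auto simp: K_def)
  have wL2: "(\<lambda>m. w (X m)) \<in> L2 M"
    by (rule L2_cong_AE[OF pL2]) (use pw in auto)
  have le: "ip M (\<lambda>m. Z m - p m) (\<lambda>m. \<phi> (X m)) \<le> 0"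
    if [measurable]: "\<phi> \<in> borel_measurable borel" and "(\<lambda>m. \<phi> (X m)) \<in> L2 M" for \<phi>
  proof (rule closest_first_variation[OF p pL2 Z that(2) zero_less_one])
    fix \<epsilon> :: real
    have "AE m in M. p m + \<epsilon> * \<phi> (X m) = w (X m) + \<epsilon> * \<phi> (X m)" using pw by eventually_elim simp
    moreover have "(\<lambda>x. w x + \<epsilon> * \<phi> x) \<in> borel_measurable borel" by simp
    ultimately show "(\<lambda>m. p m + \<epsilon> * \<phi> (X m)) \<in> K"
      unfolding K_def using pL2 that(2)
      by (auto intro!: L2_add L2_scale bexI[of _ "\<lambda>x. w x + \<epsilon> * \<phi> x"])
  qed
  have "ip M Z (\<lambda>m. \<phi> (X m)) = ip M (\<lambda>m. w (X m)) (\<lambda>m. \<phi> (X m))"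
    if [measurable]: "\<phi> \<in> borel_measurable borel" and \<phi>: "(\<lambda>m. \<phi> (X m)) \<in> L2 M" for \<phi>
  proof -
    have "ip M (\<lambda>m. Z m - p m) (\<lambda>m. \<phi> (X m)) = 0"
      using le[OF that] le[of "\<lambda>x. - \<phi> x"] L2_uminus[OF \<phi>] ip_uminus_right[OF \<phi> L2_diff[OF Z pL2]]
      by simp
    then have "ip M Z (\<lambda>m. \<phi> (X m)) = ip M p (\<lambda>m. \<phi> (X m))"
      using ip_diff_left[OF Z \<phi> pL2] by simp
    also have "\<dots> = ip M (\<lambda>m. w (X m)) (\<lambda>m. \<phi> (X m))"
      using pw L2_measurable[OF pL2] by (intro ip_cong_AE) auto
    finally show ?thesis .
  qed
  then show ?thesis using w wL2 unfolding is_cexp_def by blast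
qed

lemma is_cexp_D:
  assumes "is_cexp M X Z w"
  shows is_cexp_measurable: "w \<in> borel_measurable borel"
    and is_cexp_L2: "(\<lambda>m. w (X m)) \<in> L2 M"
    and is_cexp_ip: "\<phi> \<in> borel_measurable borel \<Longrightarrow> (\<lambda>m. \<phi> (X m)) \<in> L2 M \<Longrightarrow>
      ip M Z (\<lambda>m. \<phi> (X m)) = ip M (\<lambda>m. w (X m)) (\<lambda>m. \<phi> (X m))"
  using assms by (auto simp: is_cexp_def)

lemma is_cexp_uminus:
  assumes "is_cexp M X Z w" "Z \<in> L2 M"
  shows "is_cexp M X (\<lambda>m. - Z m) (\<lambda>x. - w x)"
  using assms by (auto simp: is_cexp_def ip_uminus_left L2_uminus)

text \<open>
  Testing with the indicator of \<open>{X \<in> S, w(X) > c}\<close>, on which \<open>w(X) - Z\<close> is positive but has integral zero.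
\<close>
lemma is_cexp_le:
  assumes fin: "finite_measure M" and X [measurable]: "X \<in> borel_measurable M"
    and Z: "Z \<in> L2 M" and w: "is_cexp M X Z w" and S [measurable]: "S \<in> sets borel"
    and le: "AE m in M. X m \<in> S \<longrightarrow> Z m \<le> c"
  shows "AE m in M. X m \<in> S \<longrightarrow> w (X m) \<le> c"
proof -
  note wD = is_cexp_D[OF w]
  note [measurable] = wD(1) L2_measurable[OF Z]
  define \<phi> :: "real \<Rightarrow> real" where "\<phi> = indicator (S \<inter> {x. c < w x})"
  have \<phi> [measurable]: "\<phi> \<in> borel_measurable borel" unfolding \<phi>_def by measurable
  have \<phi>X: "(\<lambda>m. \<phi> (X m)) \<in> L2 M"
    by (rule L2_bounded[OF fin, of _ 1]) (auto simp: \<phi>_def indicator_def)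
  have "ip M (\<lambda>m. w (X m) - Z m) (\<lambda>m. \<phi> (X m)) = 0"
    using wD(3)[OF \<phi> \<phi>X] by (simp add: ip_diff_left wD(2) \<phi>X Z)
  moreover have "AE m in M. 0 \<le> (w (X m) - Z m) * \<phi> (X m)"
    using le by eventually_elim (auto simp: \<phi>_def indicator_def)
  moreover have "integrable M (\<lambda>m. (w (X m) - Z m) * \<phi> (X m))"
    by (rule L2_mult_integrable[OF L2_diff[OF wD(2) Z] \<phi>X])
  ultimately have "AE m in M. (w (X m) - Z m) * \<phi> (X m) = 0"
    using integral_nonneg_eq_0_iff_AE unfolding ip_def by blast
  then show ?thesis using le
    by eventually_elim (auto simp: \<phi>_def indicator_def split: if_splits)
qed

lemma is_cexp_ge:
  assumes "finite_measure M" "X \<in> borel_measurable M" "Z \<in> L2 M" "is_cexp M X Z w" "S \<in> sets borel"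
    and "AE m in M. X m \<in> S \<longrightarrow> c \<le> Z m"
  shows "AE m in M. X m \<in> S \<longrightarrow> c \<le> w (X m)"
  using is_cexp_le[OF assms(1,2) L2_uminus[OF assms(3)] is_cexp_uminus[OF assms(4,3)] assms(5), of "- c"]
    assms(6) by simp

lemma mono_on_common:
  assumes "mono_AE \<mu> X" "mono_AE \<mu> Z"
  obtains A where "AE m in \<mu>. m \<in> A" "mono_on A X" "mono_on A Z"
proof -
  obtain A where A: "AE m in \<mu>. m \<in> A" "mono_on A X" using assms(1) by (rule mono_AE_E)
  obtain B where B: "AE m in \<mu>. m \<in> B" "mono_on B Z" using assms(2) by (rule mono_AE_E)
  have "AE m in \<mu>. m \<in> A \<inter> B" using A(1) B(1) by simp
  moreover have "mono_on (A \<inter> B) X" "mono_on (A \<inter> B) Z"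
    using A(2) B(2) by (auto intro: mono_on_subset)
  ultimately show thesis by (rule that)
qed

lemma mono_on_less:
  assumes "mono_on A X" "a \<in> A" "b \<in> A" "X a < (X b :: real)"
  shows "a < (b::real)"
  using mono_onD[OF assms(1,3,2)] assms(4) by (meson not_less)

section \<open>Conditional expectation of monotone maps\<close>

text \<open>
  For every threshold \<open>q\<close> a constant \<open>c\<close> separates the values of \<open>Z\<close> over \<open>{X \<le> q}\<close> from those over
  \<open>{X > q}\<close>, because \<open>X\<close> and \<open>Z\<close> increase together. The same constant separates the values of the
  conditional expectation, and rational thresholds suffice for monotonicity.
\<close>
lemma is_cexp_mono:
  assumes fin: "finite_measure \<mu>" and X: "X \<in> borel_measurable \<mu>" "mono_AE \<mu> X"
    and Z: "Z \<in> L2 \<mu>" "mono_AE \<mu> Z" and w: "is_cexp \<mu> X Z w"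
  shows "mono_AE \<mu> (\<lambda>m. w (X m))"
proof -
  obtain A where A: "AE m in \<mu>. m \<in> A" "mono_on A X" "mono_on A Z"
    using mono_on_common[OF X(2) Z(2)] .
  have "\<exists>B. (AE m in \<mu>. m \<in> B) \<and>
      (\<forall>m1\<in>B. \<forall>m2\<in>B. X m1 \<le> q \<longrightarrow> q < X m2 \<longrightarrow> w (X m1) \<le> w (X m2))" for q
  proof (cases "\<exists>m1\<in>A. \<exists>m2\<in>A. X m1 \<le> q \<and> q < X m2")
    case True
    then obtain m1 m2 where m: "m1 \<in> A" "m2 \<in> A" "X m1 \<le> q" "q < X m2" by blast
    define c where "c = Sup (Z ` {m\<in>A. X m \<le> q})"
    have sep: "Z m \<le> Z m'" if "m \<in> A" "m' \<in> A" "X m \<le> q" "q < X m'" for m m'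
      using mono_on_less[OF A(2) that(1,2)] mono_onD[OF A(3) that(1,2)] that(3,4) by simp
    have "Z m \<le> c" if "m \<in> A" "X m \<le> q" for m
      unfolding c_def by (rule cSup_upper) (use that m sep in \<open>auto intro!: bdd_aboveI[of _ "Z m2"]\<close>)
    then have "AE m in \<mu>. X m \<in> {..q} \<longrightarrow> Z m \<le> c"
      using A(1) by (auto elim: eventually_mono)
    then have le: "AE m in \<mu>. X m \<in> {..q} \<longrightarrow> w (X m) \<le> c"
      by (intro is_cexp_le[OF fin X(1) Z(1) w]) auto
    have "c \<le> Z m" if "m \<in> A" "q < X m" for m
      unfolding c_def by (rule cSup_least) (use that m sep in auto)
    then have "AE m in \<mu>. X m \<in> {q<..} \<longrightarrow> c \<le> Z m"
      using A(1) by (auto elim: eventually_mono)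
    then have ge: "AE m in \<mu>. X m \<in> {q<..} \<longrightarrow> c \<le> w (X m)"
      by (intro is_cexp_ge[OF fin X(1) Z(1) w]) auto
    let ?B = "{m. (X m \<in> {..q} \<longrightarrow> w (X m) \<le> c) \<and> (X m \<in> {q<..} \<longrightarrow> c \<le> w (X m))}"
    have "AE m in \<mu>. m \<in> ?B" using le ge by eventually_elim simp
    moreover have "\<forall>m1\<in>?B. \<forall>m2\<in>?B. X m1 \<le> q \<longrightarrow> q < X m2 \<longrightarrow> w (X m1) \<le> w (X m2)"
      by fastforce
    ultimately show ?thesis by blast
  next
    case False
    then have "\<forall>m1\<in>A. \<forall>m2\<in>A. X m1 \<le> q \<longrightarrow> q < X m2 \<longrightarrow> w (X m1) \<le> w (X m2)" by blast
    with A(1) show ?thesis by blast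
  qed
  then obtain B where B: "\<And>q. AE m in \<mu>. m \<in> B q"
    "\<And>q m1 m2. m1 \<in> B q \<Longrightarrow> m2 \<in> B q \<Longrightarrow> X m1 \<le> q \<Longrightarrow> q < X m2 \<Longrightarrow> w (X m1) \<le> w (X m2)"
    by metis
  have "AE m in \<mu>. \<forall>q\<in>\<rat>. m \<in> B q"
    by (rule AE_ball_countable'[OF B(1) countable_rat])
  with A(1) have "AE m in \<mu>. m \<in> A \<inter> (\<Inter>q\<in>\<rat>. B q)" by eventually_elim simp
  moreover have "mono_on (A \<inter> (\<Inter>q\<in>\<rat>. B q)) (\<lambda>m. w (X m))"
  proof (rule mono_onI)
    fix a b assume ab: "a \<in> A \<inter> (\<Inter>q\<in>\<rat>. B q)" "b \<in> A \<inter> (\<Inter>q\<in>\<rat>. B q)" "a \<le> b"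
    then have "X a \<le> X b" by (auto intro: mono_onD[OF A(2)])
    show "w (X a) \<le> w (X b)"
    proof (cases "X a = X b")
      case False
      then obtain q where "q \<in> \<rat>" "X a < q" "q < X b"
        using Rats_dense_in_real[of "X a" "X b"] \<open>X a \<le> X b\<close> by auto
      then show ?thesis using B(2)[of a q b] ab by auto
    qed simp
  qed
  ultimately show ?thesis by (rule mono_AE_I)
qed

text \<open>
  Chebyshev's inequality on every fibre of \<open>X\<close> at once, without disintegrating \<open>\<mu>\<close>: with \<open>r\<close> the value
  of \<open>H\<close> where \<open>Z - w(X)\<close> changes sign along the fibre, \<open>(H - r(X)) (Z - w(X)) \<ge> 0\<close>
  pointwise, and the term \<open>r(X) (Z - w(X))\<close> integrates to zero.
\<close>
lemma is_cexp_Chebyshev_bounded: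
  assumes fin: "finite_measure \<mu>" and X [measurable]: "X \<in> borel_measurable \<mu>" and Xm: "mono_AE \<mu> X"
    and Z: "Z \<in> L2 \<mu>" "mono_AE \<mu> Z" and w: "is_cexp \<mu> X Z w"
    and H: "H \<in> borel_measurable \<mu>" "mono_AE \<mu> H" "\<And>m. \<bar>H m\<bar> \<le> n"
  shows "0 \<le> ip \<mu> H (\<lambda>m. Z m - w (X m))"
proof -
  note wD = is_cexp_D[OF w]
  have D: "(\<lambda>m. Z m - w (X m)) \<in> L2 \<mu>" by (rule L2_diff[OF Z(1) wD(2)])
  have HL2: "H \<in> L2 \<mu>" by (rule L2_bounded[OF fin H(1,3)])
  obtain A where A: "AE m in \<mu>. m \<in> A" "mono_on A X" "mono_on A Z" "mono_on A H"
  proof -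
    obtain A where A: "AE m in \<mu>. m \<in> A" "mono_on A X" "mono_on A Z"
      using mono_on_common[OF Xm Z(2)] .
    obtain B where B: "AE m in \<mu>. m \<in> B" "mono_on B H" using H(2) by (rule mono_AE_E)
    have "AE m in \<mu>. m \<in> A \<inter> B" using A(1) B(1) by simp
    then show thesis using A B by (intro that[of "A \<inter> B"]) (auto intro: mono_on_subset)
  qed
  have n: "0 \<le> n" using H(3)[of 0] by linarith
  \<comment> \<open>The fibres to the left of \<open>x\<close> are included in \<open>T x\<close> to make \<open>r\<close> nondecreasing, hence Borel;
    they do not lift \<open>r x\<close> above the values of \<open>H\<close> on the fibre of \<open>x\<close>. The element \<open>- n\<close> keeps \<open>T x\<close>
    nonempty.\<close>
  define T where "T x = insert (- n) (H ` {m\<in>A. X m < x \<or> X m = x \<and> Z m \<le> w x})" for x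
  define r where "r x = Sup (T x)" for x
  have Tn: "\<bar>y\<bar> \<le> n" if "y \<in> T x" for x y using that H(3) n by (auto simp: T_def)
  have bdd: "bdd_above (T x)" for x
    by (rule bdd_aboveI[of _ n]) (use Tn in \<open>auto dest: abs_le_D1\<close>)
  have "mono r"
    unfolding r_def by (intro monoI cSup_subset_mono bdd) (auto simp: T_def)
  then have r [measurable]: "r \<in> borel_measurable borel" by (rule borel_measurable_mono)
  have r_bound: "\<bar>r x\<bar> \<le> n" for x
  proof -
    have "r x \<le> n" unfolding r_def by (rule cSup_least) (use Tn[of _ x] in \<open>auto simp: T_def abs_le_iff\<close>)
    moreover have "- n \<le> r x" unfolding r_def by (rule cSup_upper[OF _ bdd]) (simp add: T_def)
    ultimately show ?thesis by simp
  qed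
  have rX: "(\<lambda>m. r (X m)) \<in> L2 \<mu>" by (rule L2_bounded[OF fin _ r_bound]) simp
  have sign: "0 \<le> (H m - r (X m)) * (Z m - w (X m))" if m: "m \<in> A" for m
  proof (cases "Z m \<le> w (X m)")
    case True
    then have "H m \<le> r (X m)"
      unfolding r_def by (intro cSup_upper[OF _ bdd]) (auto simp: T_def m)
    then show ?thesis using True by (intro mult_nonpos_nonpos) auto
  next
    case False
    have "y \<le> H m" if y: "y \<in> T (X m)" for y
    proof -
      consider "y = - n" | m' where "m' \<in> A" "y = H m'" "X m' < X m"
        | m' where "m' \<in> A" "y = H m'" "X m' = X m" "Z m' \<le> w (X m)"
        using y by (auto simp: T_def)
      then show ?thesis
      proof cases
        case 1 then show ?thesis using H(3)[of m] by linarith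
      next
        case (2 m')
        then have "m' < m" using mono_on_less[OF A(2) _ m] by simp
        then show ?thesis using mono_onD[OF A(4) _ m, of m'] 2 by simp
      next
        case (3 m')
        then have "Z m' < Z m" using False by simp
        then have "m' < m" using mono_on_less[OF A(3) _ m] 3 by simp
        then show ?thesis using mono_onD[OF A(4) _ m, of m'] 3 by simp
      qed
    qed
    then have "r (X m) \<le> H m" unfolding r_def by (intro cSup_least) (auto simp: T_def)
    then show ?thesis using False by simp
  qed
  have "0 \<le> ip \<mu> (\<lambda>m. H m - r (X m)) (\<lambda>m. Z m - w (X m))"
    unfolding ip_def by (rule integral_nonneg_AE) (use A(1) sign in \<open>auto elim: eventually_mono\<close>)
  also have "\<dots> = ip \<mu> H (\<lambda>m. Z m - w (X m)) - ip \<mu> (\<lambda>m. r (X m)) (\<lambda>m. Z m - w (X m))"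
    by (rule ip_diff_left[OF HL2 D rX])
  also have "ip \<mu> (\<lambda>m. r (X m)) (\<lambda>m. Z m - w (X m)) = 0"
    using wD(3)[OF r rX] ip_diff_left[OF Z(1) rX wD(2)] by (simp add: ip_commute)
  finally show ?thesis by simp
qed

text \<open>
  Truncation of \<open>H\<close> preserves monotonicity and reduces to the bounded case.
\<close>
lemma is_cexp_Chebyshev:
  assumes fin: "finite_measure \<mu>" and X [measurable]: "X \<in> borel_measurable \<mu>" and Xm: "mono_AE \<mu> X"
    and Z: "Z \<in> L2 \<mu>" "mono_AE \<mu> Z" and w: "is_cexp \<mu> X Z w"
    and H: "H \<in> L2 \<mu>" "mono_AE \<mu> H"
  shows "ip \<mu> H (\<lambda>m. w (X m)) \<le> ip \<mu> H Z"
proof -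
  let ?D = "\<lambda>m. Z m - w (X m)"
  have D: "?D \<in> L2 \<mu>" by (rule L2_diff[OF Z(1) is_cexp_L2[OF w]])
  note [measurable] = L2_measurable[OF H(1)] L2_measurable[OF D]
  define f where "f n x = max (- real n) (min (real n) x)" for n and x :: real
  have mono_f: "mono (f n)" for n
    unfolding f_def by (intro monoI max.mono min.mono) auto
  have [measurable]: "f n \<in> borel_measurable borel" for n by (rule borel_measurable_mono[OF mono_f])
  have f_bound: "\<bar>f n x\<bar> \<le> real n" "\<bar>f n x\<bar> \<le> \<bar>x\<bar>" for n x by (auto simp: f_def)
  have "0 \<le> ip \<mu> (\<lambda>m. f n (H m)) ?D" for n
    by (rule is_cexp_Chebyshev_bounded[OF fin X Xm Z w _ mono_AE_compose[OF H(2) mono_f] f_bound(1)]) simp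
  moreover have "(\<lambda>n. ip \<mu> (\<lambda>m. f n (H m)) ?D) \<longlonglongrightarrow> ip \<mu> H ?D"
    unfolding ip_def
  proof (rule integral_dominated_convergence[where w = "\<lambda>m. \<bar>H m * ?D m\<bar>"])
    show "integrable \<mu> (\<lambda>m. \<bar>H m * ?D m\<bar>)" using L2_mult_integrable[OF H(1) D] by simp
    have "(\<lambda>n. f n x) \<longlonglongrightarrow> x" for x
    proof (rule tendsto_eventually)
      show "\<forall>\<^sub>F n in sequentially. f n x = x"
        using eventually_ge_at_top[of "nat \<lceil>\<bar>x\<bar>\<rceil>"]
        by eventually_elim (auto simp: f_def min_def max_def; linarith)
    qed
    then show "AE m in \<mu>. (\<lambda>n. f n (H m) * ?D m) \<longlonglongrightarrow> H m * ?D m"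
      by (intro AE_I2 tendsto_intros)
    show "AE m in \<mu>. norm (f n (H m) * ?D m) \<le> \<bar>H m * ?D m\<bar>" for n
      using f_bound(2) by (auto simp: abs_mult intro!: AE_I2 mult_right_mono)
  qed simp_all
  ultimately have "0 \<le> ip \<mu> H ?D" by (intro LIMSEQ_le_const) auto
  then show ?thesis using ip_diff_right[OF Z(1) H(1) is_cexp_L2[OF w]] by simp
qed

section \<open>The projected flow\<close>

text \<open>
  The initial velocity \<open>V0\<close> is an arbitrary element of \<open>L\<^sup>2(\<mu>)\<close> here, so that the locale also applies to
  the time-reversed flow. The function \<open>v t\<close> is the Eulerian velocity at time \<open>t\<close>.
\<close>
locale projected_flow =
  fixes \<mu> :: "real measure" and X0 V0 :: "real \<Rightarrow> real" and X v :: "real \<Rightarrow> real \<Rightarrow> real"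
  assumes sets_\<mu>: "sets \<mu> = sets borel" and finite_\<mu>: "finite_measure \<mu>"
    and X0: "X0 \<in> monotone_maps \<mu>" and V0: "V0 \<in> L2 \<mu>"
    and closest_X: "\<And>t. closest \<mu> (monotone_maps \<mu>) (\<lambda>m. X0 m + t * V0 m) (X t)"
    and cexp_v: "\<And>t. is_cexp \<mu> (X t) V0 (v t)"
begin

text \<open>
  \<open>Y\<close> is the free flow, before projection; \<open>V\<close> is the Lagrangian velocity.
\<close>
definition "Y t m = X0 m + t * V0 m"
definition "V t m = v t (X t m)"
definition "energy t = ip \<mu> (V t) (V t)"

lemma X_monotone: "X t \<in> monotone_maps \<mu>"
  using closest_X by (simp add: closest_def)

lemma X_mono_AE: "mono_AE \<mu> (X t)"
  using X_monotone sets_\<mu> by (simp add: monotone_maps_iff)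

lemma X_L2: "X t \<in> L2 \<mu>"
  by (rule monotone_maps_L2[OF X_monotone])

lemma X0_L2: "X0 \<in> L2 \<mu>"
  by (rule monotone_maps_L2[OF X0])

lemma Y_L2: "Y t \<in> L2 \<mu>"
  unfolding Y_def by (intro L2_add L2_scale X0_L2 V0)

lemma V_L2: "V t \<in> L2 \<mu>"
  unfolding V_def by (rule is_cexp_L2[OF cexp_v])

lemmas [measurable] = L2_measurable[OF X_L2] L2_measurable[OF V0] L2_measurable[OF V_L2]
  L2_measurable[OF X0_L2] is_cexp_measurable[OF cexp_v]

lemma closest_Y: "closest \<mu> (monotone_maps \<mu>) (Y t) (X t)"
  using closest_X[of t] by (simp add: Y_def[abs_def])

lemma monotone_maps_subset: "monotone_maps \<mu> \<subseteq> L2 \<mu>"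
  by (auto simp: monotone_maps_L2)

lemma ip_Y:
  assumes "f \<in> L2 \<mu>"
  shows "ip \<mu> (Y t) f = ip \<mu> X0 f + t * ip \<mu> V0 f"
  unfolding Y_def
  using ip_add_left[OF X0_L2 assms L2_scale[OF V0]] ip_scale_left[OF V0 assms] by simp

lemma ip_Y_le:
  assumes "Z \<in> monotone_maps \<mu>"
  shows "ip \<mu> (Y t) Z \<le> ip \<mu> (X t) Z"
proof -
  have "ip \<mu> (\<lambda>m. Y t m - X t m) Z \<le> 0"
    by (rule closest_cone_polar[OF closest_Y monotone_maps_subset Y_L2])
      (use assms sets_\<mu> in \<open>simp_all add: monotone_maps_add monotone_maps_scale\<close>)
  then show ?thesis
    using ip_diff_left[OF Y_L2 monotone_maps_L2[OF assms] X_L2] by simp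
qed

text \<open>
  The range of the conditional expectation given \<open>X t\<close>.
\<close>
definition flow_range :: "real \<Rightarrow> (real \<Rightarrow> real) set" where
  "flow_range t = {f \<in> L2 \<mu>. \<exists>\<phi>\<in>borel_measurable borel. AE m in \<mu>. f m = \<phi> (X t m)}"

lemma flow_rangeI:
  assumes "\<phi> \<in> borel_measurable borel" "(\<lambda>m. \<phi> (X t m)) \<in> L2 \<mu>"
  shows "(\<lambda>m. \<phi> (X t m)) \<in> flow_range t"
  using assms by (auto simp: flow_range_def)

lemma flow_range_diff:
  assumes "f \<in> flow_range t" "g \<in> flow_range t"
  shows "(\<lambda>m. f m - g m) \<in> flow_range t"
proof -
  obtain \<phi> \<psi> where *: "f \<in> L2 \<mu>" "g \<in> L2 \<mu>"
    "\<phi> \<in> borel_measurable borel" "\<psi> \<in> borel_measurable borel"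
    "AE m in \<mu>. f m = \<phi> (X t m)" "AE m in \<mu>. g m = \<psi> (X t m)"
    using assms by (auto simp: flow_range_def)
  have "AE m in \<mu>. f m - g m = \<phi> (X t m) - \<psi> (X t m)"
    using *(5,6) by eventually_elim simp
  moreover have "(\<lambda>x. \<phi> x - \<psi> x) \<in> borel_measurable borel" using *(3,4) by simp
  ultimately show ?thesis
    unfolding flow_range_def using *(1,2)
    by (auto intro!: L2_diff bexI[of _ "\<lambda>x. \<phi> x - \<psi> x"])
qed

lemma X_flow_range: "X t \<in> flow_range t"
  using flow_rangeI[of "\<lambda>x. x" t] X_L2 by simp

lemma V_flow_range: "V t \<in> flow_range t"
  using flow_rangeI[of "v t" t] V_L2[of t] is_cexp_measurable[OF cexp_v] by (simp add: V_def[abs_def])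

lemma ip_flow_range:
  assumes "f \<in> flow_range t"
  shows ip_Y_eq: "ip \<mu> (Y t) f = ip \<mu> (X t) f"
    and ip_V0_eq: "ip \<mu> V0 f = ip \<mu> (V t) f"
proof -
  obtain \<phi> where f: "f \<in> L2 \<mu>" and \<phi> [measurable]: "\<phi> \<in> borel_measurable borel"
    and eq: "AE m in \<mu>. f m = \<phi> (X t m)"
    using assms by (auto simp: flow_range_def)
  note [measurable] = L2_measurable[OF f] L2_measurable[OF Y_L2]
  have \<phi>X: "(\<lambda>m. \<phi> (X t m)) \<in> L2 \<mu>"
    by (rule L2_cong_AE[OF f]) (use eq in auto)
  have cong: "ip \<mu> h f = ip \<mu> h (\<lambda>m. \<phi> (X t m))" if "h \<in> borel_measurable \<mu>" for h
    using that eq by (intro ip_cong_AE) auto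
  have "ip \<mu> (\<lambda>m. Y t m - X t m) (\<lambda>m. \<phi> (X t m)) = 0"
    by (rule closest_monotone_orthogonal[OF sets_\<mu> finite_\<mu> Y_L2 closest_Y \<phi> \<phi>X])
  then show "ip \<mu> (Y t) f = ip \<mu> (X t) f"
    using ip_diff_left[OF Y_L2 \<phi>X X_L2] by (simp add: cong)
  show "ip \<mu> V0 f = ip \<mu> (V t) f"
    using is_cexp_ip[OF cexp_v \<phi> \<phi>X] by (simp add: cong V_def[abs_def])
qed

text \<open>
  Mass that has met at time \<open>s\<close> stays together. The competitor \<open>W = E[X\<^sub>t | X\<^sub>s]\<close> is monotone, pairs
  with \<open>Y\<^sub>t\<close> at least as well as \<open>X\<^sub>t\<close> does, and is strictly shorter than \<open>X\<^sub>t\<close> unless it equals \<open>X\<^sub>t\<close>.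
\<close>
lemma sticky:
  assumes "0 < s" "s < t"
  shows "\<exists>w\<in>borel_measurable borel. AE m in \<mu>. X t m = w (X s m)"
proof -
  obtain w where w: "is_cexp \<mu> (X s) (X t) w"
    using is_cexp_exists[OF finite_\<mu> _ X_L2] by (metis L2_measurable X_L2)
  let ?W = "\<lambda>m. w (X s m)"
  have W: "?W \<in> L2 \<mu>" by (rule is_cexp_L2[OF w])
  have Wr: "?W \<in> flow_range s" by (rule flow_rangeI[OF is_cexp_measurable[OF w] W])
  have "mono_AE \<mu> ?W"
    by (rule is_cexp_mono[OF finite_\<mu> _ X_mono_AE X_L2 X_mono_AE w]) simp
  then have Wm: "?W \<in> monotone_maps \<mu>" using W sets_\<mu> by (simp add: monotone_maps_iff)
  have self: "ip \<mu> (X t) ?W = ip \<mu> ?W ?W"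
    by (rule is_cexp_ip[OF w is_cexp_measurable[OF w] W])
  have Ys: "ip \<mu> (Y s) (X t) \<le> ip \<mu> (Y s) ?W"
  proof -
    have "ip \<mu> (Y s) (X t) \<le> ip \<mu> (X s) (X t)" by (rule ip_Y_le[OF X_monotone])
    also have "\<dots> = ip \<mu> (X s) ?W"
      using is_cexp_ip[OF w, of "\<lambda>x. x"] X_L2 by (simp add: ip_commute)
    also have "\<dots> = ip \<mu> (Y s) ?W" by (rule ip_Y_eq[OF Wr, symmetric])
    finally show ?thesis .
  qed
  have X0W: "ip \<mu> X0 ?W \<le> ip \<mu> X0 (X t)"
    by (rule is_cexp_Chebyshev[OF finite_\<mu> _ X_mono_AE X_L2 X_mono_AE w X0_L2])
      (use X0 sets_\<mu> in \<open>simp_all add: monotone_maps_iff\<close>)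
  have Yt: "ip \<mu> (Y t) f = t / s * ip \<mu> (Y s) f - (t / s - 1) * ip \<mu> X0 f" if "f \<in> L2 \<mu>" for f
    using \<open>0 < s\<close> by (simp add: ip_Y[OF that] field_simps)
  have "ip \<mu> (Y t) (X t) \<le> ip \<mu> (Y t) ?W"
    unfolding Yt[OF X_L2] Yt[OF W]
    by (intro diff_mono mult_left_mono Ys X0W) (use assms in auto)
  then have "ip \<mu> (X t) (X t) \<le> ip \<mu> ?W ?W"
    using ip_Y_eq[OF X_flow_range, of t] ip_Y_le[OF Wm, of t] self by simp
  moreover have "ip \<mu> (\<lambda>m. X t m - w (X s m)) (\<lambda>m. X t m - w (X s m))
      = ip \<mu> (X t) (X t) - ip \<mu> ?W ?W"
    using ip_diff_scaled[OF X_L2 W, of t 1] self by simp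
  ultimately have "AE m in \<mu>. X t m - w (X s m) = 0"
    by (intro ip_self_zero_AE L2_diff X_L2 W) simp
  then show ?thesis using is_cexp_measurable[OF w] by (intro bexI[of _ w]) auto
qed

lemma flow_range_antimono:
  assumes "0 < s" "s < t"
  shows "flow_range t \<subseteq> flow_range s"
proof
  fix f assume "f \<in> flow_range t"
  then obtain \<phi> where f: "f \<in> L2 \<mu>" "\<phi> \<in> borel_measurable borel" "AE m in \<mu>. f m = \<phi> (X t m)"
    by (auto simp: flow_range_def)
  obtain w where w: "w \<in> borel_measurable borel" "AE m in \<mu>. X t m = w (X s m)"
    using sticky[OF assms] by blast
  have "AE m in \<mu>. f m = \<phi> (w (X s m))" using f(3) w(2) by eventually_elim simp
  moreover have "(\<lambda>x. \<phi> (w x)) \<in> borel_measurable borel" using f(2) w(1) by simp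
  ultimately show "f \<in> flow_range s"
    using f(1) by (auto simp: flow_range_def intro!: bexI[of _ "\<lambda>x. \<phi> (w x)"])
qed

text \<open>
  Firm nonexpansiveness of the projection, for two points of the free flow.
\<close>
lemma increment_ip_le:
  "ip \<mu> (\<lambda>m. X t m - X s m) (\<lambda>m. X t m - X s m) \<le> (t - s) * ip \<mu> V0 (\<lambda>m. X t m - X s m)"
proof -
  let ?D = "\<lambda>m. X t m - X s m"
  have D: "?D \<in> L2 \<mu>" by (rule L2_diff[OF X_L2 X_L2])
  have "ip \<mu> (X t) ?D \<le> ip \<mu> (Y t) ?D"
    using ip_Y_le[OF X_monotone, of t s] ip_Y_eq[OF X_flow_range, of t]
      ip_diff_right[OF X_L2[of t] X_L2[of t] X_L2[of s]] ip_diff_right[OF X_L2[of t] Y_L2[of t] X_L2[of s]] by simp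
  moreover have "ip \<mu> (Y s) ?D \<le> ip \<mu> (X s) ?D"
    using ip_Y_le[OF X_monotone, of s t] ip_Y_eq[OF X_flow_range, of s]
      ip_diff_right[OF X_L2[of t] X_L2[of s] X_L2[of s]] ip_diff_right[OF X_L2[of t] Y_L2[of s] X_L2[of s]] by simp
  ultimately show ?thesis
    using ip_diff_left[OF X_L2 D X_L2, of t s] ip_Y[OF D] by (simp add: algebra_simps)
qed

lemma X_Lipschitz: "L2_norm \<mu> (\<lambda>m. X t m - X s m) \<le> \<bar>t - s\<bar> * L2_norm \<mu> V0"
proof -
  let ?D = "\<lambda>m. X t m - X s m"
  have D: "?D \<in> L2 \<mu>" by (rule L2_diff[OF X_L2 X_L2])
  have "(L2_norm \<mu> ?D)\<^sup>2 \<le> (t - s) * ip \<mu> V0 ?D"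
    using increment_ip_le by (simp add: L2_norm_square)
  also have "\<dots> \<le> \<bar>t - s\<bar> * \<bar>ip \<mu> V0 ?D\<bar>" by (simp flip: abs_mult)
  also have "\<dots> \<le> \<bar>t - s\<bar> * (L2_norm \<mu> V0 * L2_norm \<mu> ?D)"
    by (intro mult_left_mono ip_Cauchy_Schwarz V0 D) simp
  finally have "L2_norm \<mu> ?D * L2_norm \<mu> ?D \<le> (\<bar>t - s\<bar> * L2_norm \<mu> V0) * L2_norm \<mu> ?D"
    by (simp add: power2_eq_square mult.assoc)
  then show ?thesis
    using L2_norm_nonneg[of \<mu> ?D] L2_norm_nonneg[of \<mu> V0]
    by (cases "L2_norm \<mu> ?D = 0") (auto simp: mult_le_cancel_right)
qed

lemma V_norm_le: "L2_norm \<mu> (V t) \<le> L2_norm \<mu> V0"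
proof -
  have "L2_norm \<mu> (V t) * L2_norm \<mu> (V t) \<le> L2_norm \<mu> V0 * L2_norm \<mu> (V t)"
    using ip_V0_eq[OF V_flow_range, of t] ip_Cauchy_Schwarz[OF V0 V_L2, of t]
      L2_norm_square[of \<mu> "V t"] by (simp add: power2_eq_square)
  then show ?thesis
    using L2_norm_nonneg[of \<mu> "V t"] L2_norm_nonneg[of \<mu> V0]
    by (cases "L2_norm \<mu> (V t) = 0") (auto simp: mult_le_cancel_right)
qed

text \<open>
  Let \<open>Q\<close> be the difference quotient. Both \<open>X\<^sub>t\<close> and \<open>V\<^sub>t\<close> are functions of \<open>X\<^sub>s\<close> by stickiness.
  Therefore \<open>\<langle>Q, V\<^sub>t\<rangle> = \<parallel>V\<^sub>t\<parallel>\<^sup>2\<close> exactly, and firm nonexpansiveness reads \<open>\<parallel>Q\<parallel>\<^sup>2 \<le> \<langle>Q, V\<^sub>s\<rangle>\<close>. Expanding the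
  squares \<open>\<parallel>Q - V\<^sub>s\<parallel>\<^sup>2\<close> and \<open>\<parallel>Q - V\<^sub>t\<parallel>\<^sup>2\<close> shows that their sum is at most \<open>\<parallel>V\<^sub>s\<parallel>\<^sup>2 - \<parallel>V\<^sub>t\<parallel>\<^sup>2\<close>.
\<close>
lemma difference_quotient_bounds:
  assumes "0 < s" "s < t"
  defines "Q \<equiv> \<lambda>m. (X t m - X s m) / (t - s)"
  shows "(L2_norm \<mu> (\<lambda>m. Q m - V s m))\<^sup>2 \<le> energy s - energy t"
    and "(L2_norm \<mu> (\<lambda>m. Q m - V t m))\<^sup>2 \<le> energy s - energy t"
proof -
  let ?D = "\<lambda>m. X t m - X s m"
  have h: "0 < t - s" using assms by simp
  have D: "?D \<in> L2 \<mu>" by (rule L2_diff[OF X_L2 X_L2])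
  have Q: "Q \<in> L2 \<mu>" unfolding Q_def by (rule L2_divide[OF D])
  have Dr: "?D \<in> flow_range s"
    using flow_range_antimono[OF assms(1,2)] X_flow_range by (intro flow_range_diff) auto
  have ipQ: "ip \<mu> Q f = ip \<mu> ?D f / (t - s)" if "f \<in> L2 \<mu>" for f
    unfolding Q_def by (rule ip_divide_left[OF D that])
  have QVt: "ip \<mu> Q (V t) = energy t"
  proof -
    have "V t \<in> flow_range s" using flow_range_antimono[OF assms(1,2)] V_flow_range by auto
    then have "ip \<mu> ?D (V t) = (t - s) * ip \<mu> V0 (V t)"
      using ip_diff_left[OF X_L2[of t] V_L2[of t] X_L2[of s]] ip_Y_eq[OF V_flow_range[of t]]
        ip_Y_eq[of "V t" s] ip_Y[OF V_L2[of t]] by (simp add: algebra_simps)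
    also have "ip \<mu> V0 (V t) = energy t" unfolding energy_def by (rule ip_V0_eq[OF V_flow_range])
    finally show ?thesis using h by (simp add: ipQ V_L2)
  qed
  have QVs: "ip \<mu> Q Q \<le> ip \<mu> Q (V s)"
  proof -
    have "ip \<mu> Q Q = ip \<mu> ?D ?D / (t - s)\<^sup>2"
      unfolding ipQ[OF Q] using ip_divide_right[OF D D, of "t - s"]
      by (simp add: Q_def power2_eq_square)
    also have "\<dots> \<le> (t - s) * ip \<mu> V0 ?D / (t - s)\<^sup>2"
      by (intro divide_right_mono increment_ip_le) simp
    also have "\<dots> = ip \<mu> ?D (V s) / (t - s)"
      using h ip_V0_eq[OF Dr] by (simp add: power2_eq_square ip_commute)
    finally show ?thesis by (simp add: ipQ V_L2)
  qed
  have s: "(L2_norm \<mu> (\<lambda>m. Q m - V s m))\<^sup>2 = ip \<mu> Q Q - 2 * ip \<mu> Q (V s) + energy s"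
    using ip_diff_scaled[OF Q V_L2, of 1 s] by (simp add: L2_norm_square energy_def)
  have t: "(L2_norm \<mu> (\<lambda>m. Q m - V t m))\<^sup>2 = ip \<mu> Q Q - energy t"
    using ip_diff_scaled[OF Q V_L2, of 1 t] QVt by (simp add: L2_norm_square energy_def)
  show "(L2_norm \<mu> (\<lambda>m. Q m - V s m))\<^sup>2 \<le> energy s - energy t"
    using s t QVs zero_le_power2[of "L2_norm \<mu> (\<lambda>m. Q m - V t m)"] by linarith
  show "(L2_norm \<mu> (\<lambda>m. Q m - V t m))\<^sup>2 \<le> energy s - energy t"
    using s t QVs zero_le_power2[of "L2_norm \<mu> (\<lambda>m. Q m - V s m)"] by linarith
qed

lemma energy_antimono: "mono_on {0<..} (\<lambda>t. - energy t)"
proof (rule mono_onI)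
  fix s t :: real assume "s \<in> {0<..}" "t \<in> {0<..}" "s \<le> t"
  then show "- energy s \<le> - energy t"
    using order_trans[OF zero_le_power2 difference_quotient_bounds(1)[of s t]]
    by (cases "s = t") auto
qed

text \<open>
  The right difference quotients are compared with the velocity at the left end, the left ones with
  the velocity at the right end; both are \<open>V t\<close>.
\<close>
lemma has_derivative_at_continuity:
  assumes t: "0 < t" and cont: "isCont energy t"
  shows "has_L2_derivative \<mu> X (V t) t"
  unfolding has_L2_derivative_def
proof (intro conjI V_L2)
  let ?E = "\<lambda>h. L2_norm \<mu> (\<lambda>m. (X (t + h) m - X t m) / h - V t m)"
  have bound: "?E h \<le> sqrt \<bar>energy (t + h) - energy t\<bar>" if h: "h \<noteq> 0" "\<bar>h\<bar> < t" for h
  proof (cases "0 < h")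
    case True
    have "(?E h)\<^sup>2 \<le> energy t - energy (t + h)"
      using difference_quotient_bounds(1)[of t "t + h"] t True by simp
    then show ?thesis by (intro real_le_rsqrt) simp
  next
    case False
    have "(\<lambda>m. (X t m - X (t + h) m) / (t - (t + h)) - V t m)
        = (\<lambda>m. (X (t + h) m - X t m) / h - V t m)"
      using h by (simp add: fun_eq_iff field_simps)
    then have "(?E h)\<^sup>2 \<le> energy (t + h) - energy t"
      using difference_quotient_bounds(2)[of "t + h" t] h False by simp
    then show ?thesis by (intro real_le_rsqrt) simp
  qed
  have "((\<lambda>h. energy (t + h)) \<longlongrightarrow> energy t) (at 0)"
    using cont by (simp add: isCont_iff)
  then have "((\<lambda>h. sqrt \<bar>energy (t + h) - energy t\<bar>) \<longlongrightarrow> sqrt \<bar>energy t - energy t\<bar>) (at 0)"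
    by (intro tendsto_intros)
  then have lim: "((\<lambda>h. sqrt \<bar>energy (t + h) - energy t\<bar>) \<longlongrightarrow> 0) (at 0)" by simp
  show "(?E \<longlongrightarrow> 0) (at 0)"
  proof (rule tendsto_sandwich[OF _ _ tendsto_const lim])
    show "\<forall>\<^sub>F h in at 0. 0 \<le> ?E h" by (simp add: L2_norm_nonneg)
    show "\<forall>\<^sub>F h in at 0. ?E h \<le> sqrt \<bar>energy (t + h) - energy t\<bar>"
      unfolding eventually_at using t bound by (intro exI[of _ t]) (auto simp: dist_real_def)
  qed
qed

lemma has_derivative_countable:
  "countable {t. 0 < t \<and> \<not> has_L2_derivative \<mu> X (V t) t}"
proof (rule countable_subset)
  show "countable {t \<in> {0<..}. \<not> continuous (at t within {0<..}) (\<lambda>t. - energy t)}"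
    by (rule mono_on_ctble_discont[OF energy_antimono])
  show "{t. 0 < t \<and> \<not> has_L2_derivative \<mu> X (V t) t}
      \<subseteq> {t \<in> {0<..}. \<not> continuous (at t within {0<..}) (\<lambda>t. - energy t)}"
  proof safe
    fix t :: real
    assume t: "0 < t" "\<not> has_L2_derivative \<mu> X (V t) t"
      and "continuous (at t within {0<..}) (\<lambda>t. - energy t)"
    then have "isCont (\<lambda>t. - energy t) t"
      by (simp add: at_within_open[of t "{0<..}"])
    from isCont_minus[OF this] have "isCont energy t" by simp
    then show False using has_derivative_at_continuity t by simp
  qed
qed

lemma X_initial: "AE m in \<mu>. X 0 m = X0 m"
proof -
  have "\<forall>g\<in>monotone_maps \<mu>. L2_norm \<mu> (\<lambda>m. X0 m - X 0 m) \<le> L2_norm \<mu> (\<lambda>m. X0 m - g m)"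
    using closest_X[of 0] by (simp add: closest_def)
  then have "L2_norm \<mu> (\<lambda>m. X0 m - X 0 m) \<le> L2_norm \<mu> (\<lambda>m. X0 m - X0 m)"
    using X0 by (rule bspec)
  then have "ip \<mu> (\<lambda>m. X0 m - X 0 m) (\<lambda>m. X0 m - X 0 m) \<le> 0"
    unfolding L2_norm_le_iff by (simp add: ip_def)
  from ip_self_zero_AE[OF L2_diff[OF X0_L2 X_L2] this] show ?thesis by eventually_elim simp
qed

end

section \<open>Integrating the derivative of a Lipschitz function\<close>

text \<open>
  With an antiderivative \<open>\<Gamma>\<close> of \<open>g\<close>, the difference quotient \<open>(g(t + h) - g(t)) / h\<close> has the integral
  \<open>(\<Gamma>(b + h) - \<Gamma>(b)) / h - (\<Gamma>(a + h) - \<Gamma>(a)) / h\<close> over \<open>[a, b]\<close>, which tends to \<open>g(b) - g(a)\<close>.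
  The quotients are bounded by \<open>L\<close>, so dominated convergence applies off the exceptional set.
\<close>
lemma fundamental_theorem_Lipschitz_countable:
  fixes g G :: "real \<Rightarrow> real"
  assumes "a \<le> b" and Lip: "\<And>s t. \<bar>g s - g t\<bar> \<le> L * \<bar>s - t\<bar>"
    and N: "countable N" and deriv: "\<And>t. t \<in> {a..b} - N \<Longrightarrow> (g has_real_derivative G t) (at t)"
  shows "(G has_integral (g b - g a)) {a..b}"
proof -
  have cont: "continuous_on A g" for A
  proof (rule continuous_on_subset[of UNIV], rule lipschitz_on_continuous_on)
    show "\<bar>L\<bar>-lipschitz_on UNIV g"
    proof (rule lipschitz_onI)
      fix s t
      have "\<bar>g s - g t\<bar> \<le> \<bar>L\<bar> * \<bar>s - t\<bar>"
        using Lip[of s t] mult_right_mono[OF abs_ge_self[of L], of "\<bar>s - t\<bar>"] by linarith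
      then show "dist (g s) (g t) \<le> \<bar>L\<bar> * dist s t" by (simp add: dist_real_def)
    qed simp
  qed simp
  \<comment> \<open>Starting at \<open>a - 1\<close> makes \<open>\<Gamma>\<close> differentiable from both sides at \<open>a\<close>.\<close>
  define \<Gamma> where "\<Gamma> x = integral {a - 1..x} g" for x
  have \<Gamma>: "(\<Gamma> has_real_derivative g x) (at x)" if "x \<in> {a..b + 1}" for x
  proof -
    have "(\<Gamma> has_real_derivative g x) (at x within {a - 1..b + 2})"
      unfolding \<Gamma>_def by (rule integral_has_real_derivative) (use that cont in auto)
    moreover have "at x within {a - 1..b + 2} = at x"
      using that by (intro at_within_interior) auto
    ultimately show ?thesis by simp
  qed
  define h :: "nat \<Rightarrow> real" where "h n = inverse (real (Suc n))" for n
  have h: "0 < h n" "h n \<le> 1" for n by (simp_all add: h_def inverse_le_1_iff)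
  have h_lim: "filterlim h (at 0) sequentially"
    using LIMSEQ_inverse_real_of_nat h by (auto simp: filterlim_at h_def[abs_def] less_imp_neq[symmetric])
  define q where "q n t = (g (t + h n) - g t) / h n" for n t
  have q_integral: "(q n has_integral (\<Gamma> (b + h n) - \<Gamma> b) / h n - (\<Gamma> (a + h n) - \<Gamma> a) / h n) {a..b}" for n
  proof -
    have "(q n has_integral (\<Gamma> (b + h n) - \<Gamma> b) / h n - (\<Gamma> (a + h n) - \<Gamma> a) / h n) {a..b}"
      unfolding q_def
    proof (rule fundamental_theorem_of_calculus[OF \<open>a \<le> b\<close>])
      fix t assume t: "t \<in> {a..b}"
      have "((\<lambda>t. (\<Gamma> (t + h n) - \<Gamma> t) / h n) has_real_derivative (g (t + h n) - g t) / h n) (at t)"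
        using \<Gamma>[of t] DERIV_shift[of \<Gamma> "g (t + h n)" t "h n"] \<Gamma>[of "t + h n"] h[of n] t
        by (intro DERIV_cdivide DERIV_diff) auto
      then show "((\<lambda>t. (\<Gamma> (t + h n) - \<Gamma> t) / h n) has_vector_derivative (g (t + h n) - g t) / h n)
          (at t within {a..b})"
        by (simp add: has_real_derivative_iff_has_vector_derivative has_vector_derivative_at_within)
    qed
    then show ?thesis .
  qed
  have \<Gamma>_lim: "(\<lambda>n. (\<Gamma> (x + h n) - \<Gamma> x) / h n) \<longlonglongrightarrow> g x" if "x \<in> {a..b + 1}" for x
    using filterlim_compose[OF _ h_lim] \<Gamma>[OF that] by (simp add: DERIV_def)
  have negligible_if_countable: "negligible N"
    using countable_imp_null_set_lborel[OF N] by (simp add: negligible_iff_null_sets null_sets_completionI)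
  have null: "negligible ({a..b} - ({a..b} - N))"
    by (rule negligible_subset[OF negligible_if_countable]) auto
  have spike: "(f has_integral I) ({a..b} - N) \<longleftrightarrow> (f has_integral I) {a..b}" for f :: "real \<Rightarrow> real" and I
    by (rule has_integral_spike_set_eq) (use null in \<open>auto elim!: negligible_subset\<close>)
  have q_int: "q n integrable_on ({a..b} - N)" for n
    using q_integral[of n] by (auto simp: spike integrable_on_def)
  have const: "(\<lambda>t. L) integrable_on ({a..b} - N)"
    using integrable_const_ivl[of L a b] by (auto simp: spike integrable_on_def)
  have q_bound: "norm (q n t) \<le> L" for n t
    using Lip[of "t + h n" t] h[of n] by (simp add: q_def field_simps)
  have q_lim: "(\<lambda>n. q n t) \<longlonglongrightarrow> G t" if "t \<in> {a..b} - N" for t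
    using filterlim_compose[OF _ h_lim] deriv[OF that] by (simp add: DERIV_def q_def)
  have "G integrable_on ({a..b} - N)"
    and lim1: "(\<lambda>n. integral ({a..b} - N) (q n)) \<longlonglongrightarrow> integral ({a..b} - N) G"
    using dominated_convergence[OF q_int const q_bound q_lim] by auto
  then have G: "(G has_integral integral ({a..b} - N) G) {a..b}"
    unfolding spike[symmetric] by (simp add: has_integral_integral)
  have "integral ({a..b} - N) (q n) = (\<Gamma> (b + h n) - \<Gamma> b) / h n - (\<Gamma> (a + h n) - \<Gamma> a) / h n" for n
    using q_integral[of n] by (intro integral_unique) (simp add: spike)
  with lim1 have "(\<lambda>n. (\<Gamma> (b + h n) - \<Gamma> b) / h n - (\<Gamma> (a + h n) - \<Gamma> a) / h n)
      \<longlonglongrightarrow> integral ({a..b} - N) G" by simp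
  moreover have "(\<lambda>n. (\<Gamma> (b + h n) - \<Gamma> b) / h n - (\<Gamma> (a + h n) - \<Gamma> a) / h n) \<longlonglongrightarrow> g b - g a"
    using \<open>a \<le> b\<close> by (intro tendsto_diff \<Gamma>_lim) auto
  ultimately have "integral ({a..b} - N) G = g b - g a" by (rule LIMSEQ_unique)
  then show ?thesis using G by simp
qed

section \<open>Test functions on the half-plane\<close>

lemma at_within_Ici_not_bot: "0 \<le> t \<Longrightarrow> at t within {0..} \<noteq> bot" for t :: real
proof -
  assume "0 \<le> t"
  moreover have "t islimpt {t..t + 1}" by simp
  ultimately have "t islimpt {0..}" by (intro islimpt_subset[of t "{t..t + 1}" "{0..}"]) auto
  then show ?thesis by (simp add: trivial_limit_within)
qed

lemma test_function_C1:
  assumes "\<phi> \<in> test_functions"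
  shows test_function_has_derivative: "\<And>z. z \<in> half_plane \<Longrightarrow> (\<phi> has_derivative
      (\<lambda>h. deriv_t \<phi> (fst z) (snd z) * fst h + deriv_x \<phi> (fst z) (snd z) * snd h)) (at z within half_plane)"
    and test_function_continuous_deriv_t: "continuous_on half_plane (\<lambda>z. deriv_t \<phi> (fst z) (snd z))"
    and test_function_continuous_deriv_x: "continuous_on half_plane (\<lambda>z. deriv_x \<phi> (fst z) (snd z))"
proof -
  have "Ck_on (Suc 0) half_plane \<phi>" using assms by (simp only: test_functions_def mem_Collect_eq)
  then obtain f1 f2 where
    deriv: "\<And>z. z \<in> half_plane \<Longrightarrow>
       (\<phi> has_derivative (\<lambda>h. f1 z * fst h + f2 z * snd h)) (at z within half_plane)"
    and cont: "continuous_on half_plane f1" "continuous_on half_plane f2"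
    by auto
  have dt: "deriv_t \<phi> t x = f1 (t, x)" if "0 \<le> t" for t x
  proof -
    have "((\<lambda>s. \<phi> (s, x)) has_derivative (\<lambda>h. f1 (t, x) * fst (h, 0::real) + f2 (t, x) * snd (h, 0))) (at t within {0..})"
    proof (rule has_derivative_in_compose[where f = "\<lambda>s. (s, x)"])
      show "((\<lambda>s. (s, x)) has_derivative (\<lambda>h. (h, 0))) (at t within {0..})"
        by (auto intro!: derivative_eq_intros)
      show "(\<phi> has_derivative (\<lambda>h. f1 (t, x) * fst h + f2 (t, x) * snd h))
          (at (t, x) within (\<lambda>s. (s, x)) ` {0..})"
        by (rule has_derivative_subset[OF deriv]) (use that in auto)
    qed
    then have "((\<lambda>s. \<phi> (s, x)) has_vector_derivative f1 (t, x)) (at t within {0..})"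
      by (simp add: has_vector_derivative_def mult.commute)
    then show ?thesis
      unfolding deriv_t_def by (rule vector_derivative_within[OF at_within_Ici_not_bot[OF that]])
  qed
  have dx: "deriv_x \<phi> t x = f2 (t, x)" if "0 \<le> t" for t x
  proof -
    have "((\<lambda>y. \<phi> (t, y)) has_derivative (\<lambda>h. f1 (t, x) * fst (0::real, h) + f2 (t, x) * snd (0::real, h))) (at x)"
    proof (rule has_derivative_in_compose[where f = "\<lambda>y. (t, y)"])
      show "((\<lambda>y. (t, y)) has_derivative (\<lambda>h. (0, h))) (at x)"
        by (auto intro!: derivative_eq_intros)
      show "(\<phi> has_derivative (\<lambda>h. f1 (t, x) * fst h + f2 (t, x) * snd h))
          (at (t, x) within range (\<lambda>y. (t, y)))"
        by (rule has_derivative_subset[OF deriv]) (use that in auto)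
    qed
    then have "((\<lambda>y. \<phi> (t, y)) has_real_derivative f2 (t, x)) (at x)"
      by (simp add: has_field_derivative_def)
    then show ?thesis unfolding deriv_x_def by (rule DERIV_imp_deriv)
  qed
  have eq: "deriv_t \<phi> (fst z) (snd z) = f1 z" "deriv_x \<phi> (fst z) (snd z) = f2 z" if "z \<in> half_plane" for z
    using that dt[of "fst z" "snd z"] dx[of "fst z" "snd z"] by auto
  show "(\<phi> has_derivative
      (\<lambda>h. deriv_t \<phi> (fst z) (snd z) * fst h + deriv_x \<phi> (fst z) (snd z) * snd h)) (at z within half_plane)"
    if "z \<in> half_plane" for z
    using deriv[OF that] by (simp add: eq[OF that])
  show "continuous_on half_plane (\<lambda>z. deriv_t \<phi> (fst z) (snd z))"
    "continuous_on half_plane (\<lambda>z. deriv_x \<phi> (fst z) (snd z))"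
    using cont by (simp_all only: eq cong: continuous_on_cong)
qed

text \<open>
  At the boundary \<open>t = 0\<close> this uses that one-sided time derivatives are determined by the values in the
  half-plane.
\<close>
lemma test_function_vanishes:
  assumes t: "0 \<le> t" and z: "(t, x) \<notin> closure {z \<in> half_plane. \<phi> z \<noteq> 0}" (is "_ \<notin> ?K")
  shows "\<phi> (t, x) = 0" "deriv_t \<phi> t x = 0" "deriv_x \<phi> t x = 0"
proof -
  have zero_off_K: "\<phi> z = 0" if "z \<in> half_plane" "z \<notin> ?K" for z
    using that closure_subset[of "{z \<in> half_plane. \<phi> z \<noteq> 0}"] by auto
  then show "\<phi> (t, x) = 0" using t z by auto
  have "open (- ?K)" by (simp add: open_Compl)
  then obtain e where e: "0 < e" "ball (t, x) e \<subseteq> - ?K" using z by (auto elim: openE)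
  have off: "\<phi> (s, y) = 0" if "0 \<le> s" "dist (t, x) (s, y) < e" for s y
    by (rule zero_off_K) (use e that in auto)
  have "((\<lambda>s. \<phi> (s, x)) has_vector_derivative 0) (at t within {0..})"
  proof (rule has_vector_derivative_transform_within[OF _ e(1)])
    show "((\<lambda>s. 0 :: real) has_vector_derivative 0) (at t within {0..})"
      by (rule has_vector_derivative_const)
  qed (use off t in \<open>auto simp: dist_Pair_Pair dist_commute\<close>)
  then show "deriv_t \<phi> t x = 0"
    unfolding deriv_t_def by (rule vector_derivative_within[OF at_within_Ici_not_bot[OF t]])
  have "((\<lambda>y. \<phi> (t, y)) has_real_derivative 0) (at x)"
  proof (rule has_field_derivative_transform_within[OF _ e(1)])
    show "((\<lambda>y. 0 :: real) has_real_derivative 0) (at x)" by simp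
  qed (use off t in \<open>auto simp: dist_Pair_Pair dist_commute\<close>)
  then show "deriv_x \<phi> t x = 0" unfolding deriv_x_def by (rule DERIV_imp_deriv)
qed

lemma test_function_time_support:
  assumes "\<phi> \<in> test_functions"
  obtains T where "0 < T" "\<And>t x. T \<le> t \<Longrightarrow> \<phi> (t, x) = 0 \<and> deriv_t \<phi> t x = 0 \<and> deriv_x \<phi> t x = 0"
proof -
  let ?K = "closure {z \<in> half_plane. \<phi> z \<noteq> 0}"
  have "bounded ?K" using assms by (intro compact_imp_bounded) (simp add: test_functions_def)
  then obtain c where c: "\<And>z. z \<in> ?K \<Longrightarrow> norm z \<le> c" by (auto simp: bounded_iff)
  show thesis
  proof (rule that[of "\<bar>c\<bar> + 1"])
    fix t x :: real assume t: "\<bar>c\<bar> + 1 \<le> t"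
    have "(t, x) \<notin> ?K"
    proof
      assume "(t, x) \<in> ?K"
      then have "norm t \<le> c" using c norm_fst_le[of t x] order_trans by blast
      then show False using t by simp
    qed
    then show "\<phi> (t, x) = 0 \<and> deriv_t \<phi> t x = 0 \<and> deriv_x \<phi> t x = 0"
      using test_function_vanishes[of t x \<phi>] t by auto
  qed simp
qed

text \<open>
  The derivatives are continuous and vanish off a compact set.
\<close>
lemma test_function_bounded_deriv:
  assumes "\<phi> \<in> test_functions"
  obtains B where "0 \<le> B"
    "\<And>t x. 0 \<le> t \<Longrightarrow> \<bar>deriv_t \<phi> t x\<bar> \<le> B" "\<And>t x. 0 \<le> t \<Longrightarrow> \<bar>deriv_x \<phi> t x\<bar> \<le> B"
proof -
  let ?K = "closure {z \<in> half_plane. \<phi> z \<noteq> 0}"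
  have K: "compact ?K" using assms by (simp add: test_functions_def)
  have K_sub: "?K \<subseteq> half_plane"
    by (rule closure_minimal) (auto intro: closed_Times)
  have bd: "\<exists>B. \<forall>z\<in>?K. \<bar>f z\<bar> \<le> B" if "continuous_on half_plane f" for f :: "real \<times> real \<Rightarrow> real"
  proof -
    have "bounded (f ` ?K)"
      by (intro compact_imp_bounded compact_continuous_image K continuous_on_subset[OF that K_sub])
    then show ?thesis by (auto simp: bounded_iff)
  qed
  obtain B1 where B1: "\<And>z. z \<in> ?K \<Longrightarrow> \<bar>deriv_t \<phi> (fst z) (snd z)\<bar> \<le> B1"
    using bd[OF test_function_continuous_deriv_t[OF assms]] by auto
  obtain B2 where B2: "\<And>z. z \<in> ?K \<Longrightarrow> \<bar>deriv_x \<phi> (fst z) (snd z)\<bar> \<le> B2"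
    using bd[OF test_function_continuous_deriv_x[OF assms]] by auto
  show thesis
  proof (rule that[of "max 0 (max B1 B2)"])
    fix t x :: real assume t: "0 \<le> t"
    show "\<bar>deriv_t \<phi> t x\<bar> \<le> max 0 (max B1 B2)" "\<bar>deriv_x \<phi> t x\<bar> \<le> max 0 (max B1 B2)"
      using B1[of "(t, x)"] B2[of "(t, x)"] test_function_vanishes[OF t, of x \<phi>]
      by (cases "(t, x) \<in> ?K"; auto)+
  qed simp
qed

lemma test_function_Lipschitz:
  assumes "\<phi> \<in> test_functions"
  obtains L where "0 \<le> L"
    "\<And>t x s y. 0 \<le> t \<Longrightarrow> 0 \<le> s \<Longrightarrow> \<bar>\<phi> (t, x) - \<phi> (s, y)\<bar> \<le> L * (\<bar>t - s\<bar> + \<bar>x - y\<bar>)"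
proof -
  obtain B where B: "0 \<le> B" "\<And>t x. 0 \<le> t \<Longrightarrow> \<bar>deriv_t \<phi> t x\<bar> \<le> B" "\<And>t x. 0 \<le> t \<Longrightarrow> \<bar>deriv_x \<phi> t x\<bar> \<le> B"
    using test_function_bounded_deriv[OF assms] by blast
  show thesis
  proof (rule that[of "2 * B"])
    fix t x s y :: real assume ts: "0 \<le> t" "0 \<le> s"
    have "norm (\<phi> (t, x) - \<phi> (s, y)) \<le> 2 * B * norm ((t, x) - (s, y))"
    proof (rule differentiable_bound[OF _ test_function_has_derivative[OF assms]])
      show "convex half_plane" by (intro convex_Times) auto
      show "onorm (\<lambda>h. deriv_t \<phi> (fst z) (snd z) * fst h + deriv_x \<phi> (fst z) (snd z) * snd h) \<le> 2 * B"
        if z: "z \<in> half_plane" for z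
      proof (rule onorm_le)
        fix h :: "real \<times> real"
        let ?a = "deriv_t \<phi> (fst z) (snd z)" and ?b = "deriv_x \<phi> (fst z) (snd z)"
        have "norm (fst h) \<le> norm h" "norm (snd h) \<le> norm h"
          by (metis norm_fst_le prod.collapse, metis norm_snd_le prod.collapse)
        then have "\<bar>?a\<bar> * \<bar>fst h\<bar> \<le> B * norm h" "\<bar>?b\<bar> * \<bar>snd h\<bar> \<le> B * norm h"
          using B z by (auto intro!: mult_mono)
        then show "norm (?a * fst h + ?b * snd h) \<le> 2 * B * norm h"
          using abs_triangle_ineq[of "?a * fst h" "?b * snd h"] by (simp add: abs_mult)
      qed
    qed (use ts in auto)
    also have "\<dots> \<le> 2 * B * (\<bar>t - s\<bar> + \<bar>x - y\<bar>)"
      using norm_Pair_le[of "t - s" "x - y"] B(1) by (intro mult_left_mono) auto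
    finally show "\<bar>\<phi> (t, x) - \<phi> (s, y)\<bar> \<le> 2 * B * (\<bar>t - s\<bar> + \<bar>x - y\<bar>)" by simp
  qed (use B in simp)
qed

lemma test_function_bounded:
  assumes "\<phi> \<in> test_functions"
  obtains M where "\<And>t x. 0 \<le> t \<Longrightarrow> \<bar>\<phi> (t, x)\<bar> \<le> M"
proof -
  obtain L where L: "0 \<le> L"
    "\<And>t x s y. 0 \<le> t \<Longrightarrow> 0 \<le> s \<Longrightarrow> \<bar>\<phi> (t, x) - \<phi> (s, y)\<bar> \<le> L * (\<bar>t - s\<bar> + \<bar>x - y\<bar>)"
    using test_function_Lipschitz[OF assms] by blast
  obtain T where T: "0 < T" "\<And>t x. T \<le> t \<Longrightarrow> \<phi> (t, x) = 0 \<and> deriv_t \<phi> t x = 0 \<and> deriv_x \<phi> t x = 0"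
    using test_function_time_support[OF assms] by blast
  show thesis
  proof (rule that[of "L * T"])
    fix t x :: real assume t: "0 \<le> t"
    show "\<bar>\<phi> (t, x)\<bar> \<le> L * T"
    proof (cases "T \<le> t")
      case False
      have "\<bar>\<phi> (t, x)\<bar> \<le> L * (T - t)" using L(2)[OF t, of T x x] T(1) T(2)[of T x] False by simp
      also have "\<dots> \<le> L * T" using L(1) t by (intro mult_left_mono) auto
      finally show ?thesis .
    qed (use T L in simp)
  qed
qed

lemma test_function_Borel:
  assumes \<phi>: "\<phi> \<in> test_functions" and t: "0 \<le> t"
  shows "(\<lambda>x. \<phi> (t, x)) \<in> borel_measurable borel" "deriv_t \<phi> t \<in> borel_measurable borel"
    "deriv_x \<phi> t \<in> borel_measurable borel"
proof -
  have Borel: "(\<lambda>x. f (t, x)) \<in> borel_measurable borel"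
    if "continuous_on half_plane f" for f :: "real \<times> real \<Rightarrow> real"
    by (intro borel_measurable_continuous_onI
        continuous_on_compose2[OF that, where f = "\<lambda>x. (t, x)"] continuous_intros) (use t in auto)
  show "(\<lambda>x. \<phi> (t, x)) \<in> borel_measurable borel"
    by (rule Borel[OF has_derivative_continuous_on[OF test_function_has_derivative[OF \<phi>]]])
  show "deriv_t \<phi> t \<in> borel_measurable borel"
    using Borel[OF test_function_continuous_deriv_t[OF \<phi>]] by simp
  show "deriv_x \<phi> t \<in> borel_measurable borel"
    using Borel[OF test_function_continuous_deriv_x[OF \<phi>]] by simp
qed

lemma test_function_along_line:
  assumes "\<phi> \<in> test_functions" "0 < t"
  shows "((\<lambda>h. (\<phi> (t + h, x + h * c) - \<phi> (t, x)) / h) \<longlongrightarrow> deriv_t \<phi> t x + c * deriv_x \<phi> t x) (at 0)"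
proof -
  have "(t, x) \<in> interior half_plane"
  proof (rule interiorI)
    show "open ({0<..} \<times> UNIV :: (real \<times> real) set)" by (intro open_Times) auto
  qed (use assms(2) in auto)
  then have at: "at (t, x) within half_plane = at (t, x)" by (rule at_within_interior)
  have "((\<lambda>h. \<phi> (t + h, x + h * c)) has_derivative
      (\<lambda>k. deriv_t \<phi> t x * fst (k, k * c) + deriv_x \<phi> t x * snd (k, k * c))) (at 0)"
  proof (rule has_derivative_compose[where f = "\<lambda>h. (t + h, x + h * c)"])
    show "((\<lambda>h. (t + h, x + h * c)) has_derivative (\<lambda>k. (k, k * c))) (at 0)"
      by (auto intro!: derivative_eq_intros)
    show "(\<phi> has_derivative (\<lambda>h. deriv_t \<phi> t x * fst h + deriv_x \<phi> t x * snd h)) (at (t + 0, x + 0 * c))"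
      using test_function_has_derivative[OF assms(1), of "(t, x)"] assms(2) by (simp add: at)
  qed
  then have "((\<lambda>h. \<phi> (t + h, x + h * c)) has_real_derivative deriv_t \<phi> t x + c * deriv_x \<phi> t x) (at 0)"
    unfolding has_field_derivative_def by (rule has_derivative_eq_rhs) (simp add: fun_eq_iff algebra_simps)
  then show ?thesis by (simp add: DERIV_def)
qed

section \<open>Differentiating along the flow\<close>

context projected_flow
begin

definition "pairing \<phi> U t = ip \<mu> (\<lambda>m. \<phi> (t, X t m)) U"
definition "material_derivative \<phi> t m = deriv_t \<phi> t (X t m) + V t m * deriv_x \<phi> t (X t m)"

lemma material_derivative_eq: "material_derivative \<phi> t = (\<lambda>m. deriv_t \<phi> t (X t m) + V t m * deriv_x \<phi> t (X t m))"
  by (simp add: material_derivative_def fun_eq_iff)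

lemma test_function_L2:
  assumes "\<phi> \<in> test_functions" "0 \<le> t"
  shows "(\<lambda>m. \<phi> (t, X t m)) \<in> L2 \<mu>"
proof -
  obtain C where "\<And>t x. 0 \<le> t \<Longrightarrow> \<bar>\<phi> (t, x)\<bar> \<le> C" using test_function_bounded[OF assms(1)] by blast
  then show ?thesis
    using measurable_compose[OF L2_measurable[OF X_L2] test_function_Borel(1)[OF assms]] assms(2)
    by (intro L2_bounded[OF finite_\<mu>]) auto
qed

lemma material_derivative_L2_norm:
  assumes "\<phi> \<in> test_functions"
  obtains R where "\<And>t. 0 \<le> t \<Longrightarrow> material_derivative \<phi> t \<in> L2 \<mu> \<and> L2_norm \<mu> (material_derivative \<phi> t) \<le> R"
proof -
  obtain L where L: "0 \<le> L" "\<And>t x. 0 \<le> t \<Longrightarrow> \<bar>deriv_t \<phi> t x\<bar> \<le> L"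
    "\<And>t x. 0 \<le> t \<Longrightarrow> \<bar>deriv_x \<phi> t x\<bar> \<le> L"
    using test_function_bounded_deriv[OF assms] by blast
  show thesis
  proof (rule that)
    fix t :: real assume t: "0 \<le> t"
    note [measurable] = test_function_Borel(2,3)[OF assms t]
    have [measurable]: "material_derivative \<phi> t \<in> borel_measurable \<mu>" unfolding material_derivative_eq by simp
    let ?G = "\<lambda>m. L * (1 + \<bar>V t m\<bar>)"
    have one: "(\<lambda>m. 1) \<in> L2 \<mu>" by (rule L2_const[OF finite_\<mu>])
    have G: "?G \<in> L2 \<mu>" by (intro L2_scale L2_add one L2_abs V_L2)
    have le: "\<bar>material_derivative \<phi> t m\<bar> \<le> \<bar>?G m\<bar>" for m
    proof -
      have "\<bar>material_derivative \<phi> t m\<bar> \<le> \<bar>deriv_t \<phi> t (X t m)\<bar> + \<bar>V t m\<bar> * \<bar>deriv_x \<phi> t (X t m)\<bar>"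
        unfolding material_derivative_def by (rule order_trans[OF abs_triangle_ineq]) (simp add: abs_mult)
      also have "\<dots> \<le> L + \<bar>V t m\<bar> * L" using L t by (intro add_mono mult_left_mono) auto
      finally show ?thesis using L by (simp add: algebra_simps)
    qed
    have "L2_norm \<mu> (material_derivative \<phi> t) \<le> L2_norm \<mu> ?G" by (rule L2_norm_mono[OF _ G le]) simp
    also have "\<dots> \<le> L * (L2_norm \<mu> (\<lambda>m. 1) + L2_norm \<mu> (V t))"
      using L2_norm_triangle[OF one L2_abs[OF V_L2, of t]] L
      by (auto simp: L2_norm_scale L2_norm_abs intro!: mult_left_mono)
    also have "\<dots> \<le> L * (L2_norm \<mu> (\<lambda>m. 1) + L2_norm \<mu> V0)"
      using V_norm_le L by (intro mult_left_mono add_left_mono) auto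
    finally show "material_derivative \<phi> t \<in> L2 \<mu> \<and> L2_norm \<mu> (material_derivative \<phi> t) \<le> L * (L2_norm \<mu> (\<lambda>m. 1) + L2_norm \<mu> V0)"
      using L2_dominated[OF G, of "material_derivative \<phi> t" 1] le by simp
  qed
qed

text \<open>
  This is what lets \<open>V0\<close> be replaced by \<open>V t\<close> in the momentum equation.
\<close>
lemma material_derivative_flow_range:
  assumes "\<phi> \<in> test_functions" "0 \<le> t"
  shows "material_derivative \<phi> t \<in> flow_range t"
proof -
  note [measurable] = test_function_Borel[OF assms]
  have "material_derivative \<phi> t \<in> L2 \<mu>" using material_derivative_L2_norm[OF assms(1)] assms(2) by blast
  then show ?thesis
    using flow_rangeI[of "\<lambda>x. deriv_t \<phi> t x + v t x * deriv_x \<phi> t x" t]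
    by (simp add: material_derivative_eq V_def)
qed

lemma pairing_Lipschitz:
  assumes \<phi>: "\<phi> \<in> test_functions" and U: "U \<in> L2 \<mu>"
  obtains C where "\<And>s t. 0 \<le> s \<Longrightarrow> 0 \<le> t \<Longrightarrow> \<bar>pairing \<phi> U t - pairing \<phi> U s\<bar> \<le> C * \<bar>t - s\<bar>"
proof -
  obtain L where L: "0 \<le> L"
    "\<And>t x s y. 0 \<le> t \<Longrightarrow> 0 \<le> s \<Longrightarrow> \<bar>\<phi> (t, x) - \<phi> (s, y)\<bar> \<le> L * (\<bar>t - s\<bar> + \<bar>x - y\<bar>)"
    using test_function_Lipschitz[OF \<phi>] by blast
  let ?C = "L * (L2_norm \<mu> (\<lambda>m. 1) + L2_norm \<mu> V0)"
  have "\<bar>pairing \<phi> U t - pairing \<phi> U s\<bar> \<le> ?C * L2_norm \<mu> U * \<bar>t - s\<bar>" if s: "0 \<le> s" and t: "0 \<le> t" for s t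
  proof -
    let ?F = "\<lambda>m. \<phi> (t, X t m) - \<phi> (s, X s m)"
    let ?D = "\<lambda>m. X t m - X s m"
    let ?G = "\<lambda>m. L * (\<bar>t - s\<bar> * 1 + \<bar>?D m\<bar>)"
    have one: "(\<lambda>m. 1) \<in> L2 \<mu>" by (rule L2_const[OF finite_\<mu>])
    have D: "?D \<in> L2 \<mu>" by (rule L2_diff[OF X_L2 X_L2])
    have F: "?F \<in> L2 \<mu>" using test_function_L2[OF \<phi>] s t by (intro L2_diff) auto
    have G: "?G \<in> L2 \<mu>" by (intro L2_scale L2_add one L2_abs D)
    have "L2_norm \<mu> ?F \<le> L2_norm \<mu> ?G"
      using L(2)[OF t s] L(1) by (intro L2_norm_mono L2_measurable[OF F] G) (simp add: abs_mult)
    also have "\<dots> \<le> L * (\<bar>t - s\<bar> * L2_norm \<mu> (\<lambda>m. 1) + L2_norm \<mu> ?D)"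
      using L2_norm_triangle[OF L2_scale[OF one] L2_abs[OF D], of "\<bar>t - s\<bar>"] L(1)
        L2_norm_scale[of \<mu> "\<bar>t - s\<bar>" "\<lambda>m. 1"]
      unfolding L2_norm_scale[of \<mu> L] L2_norm_abs[of \<mu> ?D] by (auto intro!: mult_left_mono)
    also have "\<dots> \<le> L * (\<bar>t - s\<bar> * L2_norm \<mu> (\<lambda>m. 1) + \<bar>t - s\<bar> * L2_norm \<mu> V0)"
      using X_Lipschitz L(1) by (intro mult_left_mono add_left_mono) auto
    finally have norm_F: "L2_norm \<mu> ?F \<le> ?C * \<bar>t - s\<bar>" by (simp add: algebra_simps)
    have "pairing \<phi> U t - pairing \<phi> U s = ip \<mu> ?F U"
      unfolding pairing_def using ip_diff_left[OF test_function_L2[OF \<phi> t] U test_function_L2[OF \<phi> s]] by simp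
    also have "\<bar>ip \<mu> ?F U\<bar> \<le> L2_norm \<mu> ?F * L2_norm \<mu> U" by (rule ip_Cauchy_Schwarz[OF F U])
    also have "\<dots> \<le> ?C * \<bar>t - s\<bar> * L2_norm \<mu> U"
      by (rule mult_right_mono[OF norm_F L2_norm_nonneg])
    finally show ?thesis by (simp add: algebra_simps)
  qed
  then show thesis by (rule that)
qed

text \<open>
  The difference quotient of \<open>\<phi>(t, X\<^sub>t)\<close> is the sum of \<open>b\<close>, the quotient along the straight line with
  velocity \<open>V\<^sub>t\<close>, and an error \<open>a\<close>. Since \<open>\<phi>\<close> is Lipschitz, \<open>a\<close> is dominated by the error in the
  \<open>L\<^sup>2\<close>-derivative of \<open>X\<close>, while \<open>b\<close> converges pointwise and is dominated by a multiple of
  \<open>1 + \<bar>V\<^sub>t\<bar>\<close>. Only \<open>U \<in> L\<^sup>2\<close> is available, so a second-order expansion of \<open>\<phi>\<close>, whose remainder is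
  quadratic in the increment of \<open>X\<close>, need not be integrable against \<open>U\<close>.
\<close>
lemma pairing_derivative:
  assumes \<phi>: "\<phi> \<in> test_functions" and U: "U \<in> L2 \<mu>"
    and t: "0 < t" and deriv: "has_L2_derivative \<mu> X (V t) t"
  shows "(pairing \<phi> U has_real_derivative ip \<mu> (material_derivative \<phi> t) U) (at t)"
proof -
  obtain L where L: "0 \<le> L"
    "\<And>t x s y. 0 \<le> t \<Longrightarrow> 0 \<le> s \<Longrightarrow> \<bar>\<phi> (t, x) - \<phi> (s, y)\<bar> \<le> L * (\<bar>t - s\<bar> + \<bar>x - y\<bar>)"
    using test_function_Lipschitz[OF \<phi>] by blast
  note [measurable] = L2_measurable[OF U]
  have Borel: "(\<lambda>m. \<phi> (s, Z m)) \<in> borel_measurable \<mu>"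
    if "0 \<le> s" "Z \<in> borel_measurable \<mu>" for s Z
    by (rule measurable_compose[OF that(2) test_function_Borel(1)[OF \<phi> that(1)]])
  note [measurable] = test_function_Borel(2,3)[OF \<phi> less_imp_le[OF t]]
  define a where "a h m = (\<phi> (t + h, X (t + h) m) - \<phi> (t + h, X t m + h * V t m)) / h" for h m
  define b where "b h m = (\<phi> (t + h, X t m + h * V t m) - \<phi> (t, X t m)) / h" for h m
  have b_le: "\<bar>b h m\<bar> \<le> L * (1 + \<bar>V t m\<bar>)" if h: "h \<noteq> 0" "\<bar>h\<bar> < t" for h m
  proof -
    have "\<bar>b h m\<bar> \<le> L * (\<bar>h\<bar> + \<bar>h\<bar> * \<bar>V t m\<bar>) / \<bar>h\<bar>"
      using L(2)[of "t + h" t "X t m + h * V t m" "X t m"] h t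
      by (auto simp: b_def abs_mult intro!: divide_right_mono)
    also have "\<dots> = L * (1 + \<bar>V t m\<bar>)" using h by (simp add: field_simps)
    finally show ?thesis .
  qed
  have b_meas: "b h \<in> borel_measurable \<mu>" if "\<bar>h\<bar> < t" for h
    unfolding b_def[abs_def] using that t
    by (intro borel_measurable_divide borel_measurable_diff Borel) auto
  have dom: "(\<lambda>m. L * (1 + \<bar>V t m\<bar>)) \<in> L2 \<mu>"
    by (intro L2_scale L2_add L2_const[OF finite_\<mu>] L2_abs V_L2)
  have b_L2: "b h \<in> L2 \<mu>" if h: "h \<noteq> 0" "\<bar>h\<bar> < t" for h
    by (rule L2_dominated[OF dom b_meas[OF h(2)], of 1]) (use b_le[OF h] L(1) in \<open>simp add: abs_mult\<close>)
  have b_lim: "((\<lambda>h. ip \<mu> (b h) U) \<longlongrightarrow> ip \<mu> (material_derivative \<phi> t) U) (at 0 within {-t<..<t})"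
    unfolding tendsto_at_iff_sequentially
  proof (intro allI impI)
    fix h :: "nat \<Rightarrow> real"
    assume range: "\<forall>i. h i \<in> {-t<..<t} - {0}" and lim: "h \<longlonglongrightarrow> 0"
    have h: "h i \<noteq> 0" "\<bar>h i\<bar> < t" for i using spec[OF range, of i] by auto
    have h_lim: "filterlim h (at 0) sequentially" using lim h by (simp add: filterlim_at)
    show "((\<lambda>h. ip \<mu> (b h) U) \<circ> h) \<longlonglongrightarrow> ip \<mu> (material_derivative \<phi> t) U"
      unfolding ip_def comp_def
    proof (rule integral_dominated_convergence[where w = "\<lambda>m. L * (1 + \<bar>V t m\<bar>) * \<bar>U m\<bar>"])
      show "integrable \<mu> (\<lambda>m. L * (1 + \<bar>V t m\<bar>) * \<bar>U m\<bar>)"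
        by (rule L2_mult_integrable[OF dom L2_abs[OF U]])
      show "(\<lambda>m. material_derivative \<phi> t m * U m) \<in> borel_measurable \<mu>" unfolding material_derivative_def by simp
      show "(\<lambda>m. b (h i) m * U m) \<in> borel_measurable \<mu>" for i
        using b_meas[OF h(2)[of i]] by simp
      have "((\<lambda>h. b h m) \<longlongrightarrow> material_derivative \<phi> t m) (at 0)" for m
        unfolding b_def material_derivative_def by (rule test_function_along_line[OF \<phi> t])
      then show "AE m in \<mu>. (\<lambda>i. b (h i) m * U m) \<longlonglongrightarrow> material_derivative \<phi> t m * U m"
        by (intro AE_I2 tendsto_mult tendsto_const filterlim_compose[OF _ h_lim])
      show "AE m in \<mu>. norm (b (h i) m * U m) \<le> L * (1 + \<bar>V t m\<bar>) * \<bar>U m\<bar>" for i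
        using b_le[OF h] by (auto simp: abs_mult intro!: AE_I2 mult_right_mono)
    qed
  qed
  then have b_lim: "((\<lambda>h. ip \<mu> (b h) U) \<longlongrightarrow> ip \<mu> (material_derivative \<phi> t) U) (at 0)"
    using t by (simp add: at_within_open[of 0 "{-t<..<t}"])
  define E where "E h m = (X (t + h) m - X t m) / h - V t m" for h m
  have E_L2: "E h \<in> L2 \<mu>" for h
    unfolding E_def by (intro L2_diff L2_divide X_L2 V_L2)
  have a_le: "\<bar>a h m\<bar> \<le> \<bar>L * E h m\<bar>" if h: "h \<noteq> 0" "\<bar>h\<bar> < t" for h m
  proof -
    have "\<bar>a h m\<bar> \<le> L * \<bar>X (t + h) m - (X t m + h * V t m)\<bar> / \<bar>h\<bar>"
      using L(2)[of "t + h" "t + h" "X (t + h) m" "X t m + h * V t m"] h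
      by (auto simp: a_def intro!: divide_right_mono)
    also have "\<dots> = L * \<bar>E h m\<bar>"
    proof -
      have "E h m = (X (t + h) m - (X t m + h * V t m)) / h" using h by (simp add: E_def field_simps)
      then show ?thesis by simp
    qed
    finally show ?thesis using L(1) by (simp add: abs_mult)
  qed
  have a_meas: "a h \<in> borel_measurable \<mu>" if "\<bar>h\<bar> < t" for h
    unfolding a_def[abs_def] using that t
    by (intro borel_measurable_divide borel_measurable_diff Borel) auto
  have a_L2: "a h \<in> L2 \<mu>" if h: "h \<noteq> 0" "\<bar>h\<bar> < t" for h
    by (rule L2_dominated[OF L2_scale[OF E_L2, of L h] a_meas[OF h(2)], of 1]) (use a_le[OF h] in simp)
  have a_bound: "\<bar>ip \<mu> (a h) U\<bar> \<le> L * L2_norm \<mu> (E h) * L2_norm \<mu> U" if h: "h \<noteq> 0" "\<bar>h\<bar> < t" for h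
  proof -
    have "\<bar>ip \<mu> (a h) U\<bar> \<le> L2_norm \<mu> (a h) * L2_norm \<mu> U" by (rule ip_Cauchy_Schwarz[OF a_L2[OF h] U])
    also have "L2_norm \<mu> (a h) \<le> L2_norm \<mu> (\<lambda>m. L * E h m)"
      by (rule L2_norm_mono[OF a_meas[OF h(2)] L2_scale[OF E_L2] a_le[OF h]])
    finally show ?thesis using L(1) by (simp add: L2_norm_scale mult_right_mono L2_norm_nonneg)
  qed
  have near: "\<forall>\<^sub>F h in at 0. h \<noteq> 0 \<and> \<bar>h\<bar> < t"
    unfolding eventually_at using t by (intro exI[of _ t]) auto
  have a_lim: "((\<lambda>h. ip \<mu> (a h) U) \<longlongrightarrow> 0) (at 0)"
  proof (rule Lim_null_comparison)
    show "\<forall>\<^sub>F h in at 0. norm (ip \<mu> (a h) U) \<le> L * L2_norm \<mu> (E h) * L2_norm \<mu> U"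
      using near by eventually_elim (use a_bound in auto)
    have "((\<lambda>h. L2_norm \<mu> (E h)) \<longlongrightarrow> 0) (at 0)"
      using deriv by (simp add: has_L2_derivative_def E_def[abs_def])
    then have "((\<lambda>h. L * L2_norm \<mu> (E h) * L2_norm \<mu> U) \<longlongrightarrow> L * 0 * L2_norm \<mu> U) (at 0)"
      by (intro tendsto_intros)
    then show "((\<lambda>h. L * L2_norm \<mu> (E h) * L2_norm \<mu> U) \<longlongrightarrow> 0) (at 0)" by simp
  qed
  have split: "(pairing \<phi> U (t + h) - pairing \<phi> U t) / h = ip \<mu> (a h) U + ip \<mu> (b h) U"
    if h: "h \<noteq> 0" "\<bar>h\<bar> < t" for h
  proof -
    have th: "0 \<le> t + h" "0 \<le> t" using h by auto
    note F = test_function_L2[OF \<phi> th(1)] and G = test_function_L2[OF \<phi> th(2)]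
    have "(\<lambda>m. a h m + b h m) = (\<lambda>m. (\<phi> (t + h, X (t + h) m) - \<phi> (t, X t m)) / h)"
      by (simp add: a_def b_def fun_eq_iff diff_divide_distrib)
    then show ?thesis
      using ip_add_left[OF a_L2[OF h] U b_L2[OF h]] ip_divide_left[OF L2_diff[OF F G] U, of h]
        ip_diff_left[OF F U G] by (simp add: pairing_def)
  qed
  have "((\<lambda>h. (pairing \<phi> U (t + h) - pairing \<phi> U t) / h) \<longlongrightarrow> 0 + ip \<mu> (material_derivative \<phi> t) U) (at 0)"
    using tendsto_add[OF a_lim b_lim]
    by (rule Lim_transform_eventually) (use near in eventually_elim, use split in auto)
  then show ?thesis by (simp add: DERIV_def)
qed

text \<open>
  The pairing is Lipschitz in time, differentiable off a countable set, and zero for large times.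
\<close>
lemma material_derivative_integral:
  assumes \<phi>: "\<phi> \<in> test_functions" and U: "U \<in> L2 \<mu>"
  shows "set_integrable lebesgue {0..} (\<lambda>t. ip \<mu> (material_derivative \<phi> t) U)"
    and "(LINT t:{0..}|lebesgue. ip \<mu> (material_derivative \<phi> t) U) = - pairing \<phi> U 0"
proof -
  let ?G = "\<lambda>t. ip \<mu> (material_derivative \<phi> t) U"
  obtain T where T: "0 < T"
    and zero: "\<And>t x. T \<le> t \<Longrightarrow> \<phi> (t, x) = 0 \<and> deriv_t \<phi> t x = 0 \<and> deriv_x \<phi> t x = 0"
    using test_function_time_support[OF \<phi>] by blast
  obtain C where C: "\<And>s t. 0 \<le> s \<Longrightarrow> 0 \<le> t \<Longrightarrow> \<bar>pairing \<phi> U t - pairing \<phi> U s\<bar> \<le> C * \<bar>t - s\<bar>"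
    using pairing_Lipschitz[OF \<phi> U] by blast
  obtain R where R: "\<And>t. 0 \<le> t \<Longrightarrow> material_derivative \<phi> t \<in> L2 \<mu> \<and> L2_norm \<mu> (material_derivative \<phi> t) \<le> R"
    using material_derivative_L2_norm[OF \<phi>] by blast
  \<comment> \<open>Extending by the initial value makes \<open>g\<close> Lipschitz on the whole line; time \<open>0\<close> becomes one
    more exceptional point.\<close>
  define g where "g s = pairing \<phi> U (max 0 s)" for s
  let ?N = "insert 0 {t. 0 < t \<and> \<not> has_L2_derivative \<mu> X (V t) t}"
  have C0: "0 \<le> C" using C[of 0 1] by simp
  have "(?G has_integral g T - g 0) {0..T}"
  proof (rule fundamental_theorem_Lipschitz_countable[where N = ?N])
    show "\<bar>g s - g t\<bar> \<le> C * \<bar>s - t\<bar>" for s t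
    proof -
      have "\<bar>g s - g t\<bar> \<le> C * \<bar>max 0 s - max 0 t\<bar>" unfolding g_def by (rule C) auto
      also have "\<dots> \<le> C * \<bar>s - t\<bar>" by (rule mult_left_mono[OF _ C0]) auto
      finally show ?thesis .
    qed
    show "countable ?N" using has_derivative_countable by simp
    fix t assume t: "t \<in> {0..T} - ?N"
    then have "0 < t" "has_L2_derivative \<mu> X (V t) t" by auto
    then have "(pairing \<phi> U has_real_derivative ?G t) (at t)"
      by (intro pairing_derivative[OF \<phi> U])
    then show "(g has_real_derivative ?G t) (at t)"
      by (rule has_field_derivative_transform_within_open[of _ _ _ "{0<..}"])
        (use \<open>0 < t\<close> in \<open>auto simp: g_def max_def\<close>)
  qed (use T in simp)
  moreover have "g T = 0" using T zero[of T] by (simp add: g_def pairing_def ip_def)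
  ultimately have int: "(?G has_integral - pairing \<phi> U 0) {0..T}" by (simp add: g_def)
  have G0: "?G t = 0" if "T < t" for t
    using that T zero[of t] by (simp add: material_derivative_def ip_def)
  have "?G absolutely_integrable_on {0..T}"
  proof (rule absolutely_integrable_integrable_bound[where g = "\<lambda>t. R * L2_norm \<mu> U"])
    fix t assume "t \<in> {0..T}"
    then have "\<bar>?G t\<bar> \<le> L2_norm \<mu> (material_derivative \<phi> t) * L2_norm \<mu> U"
      using R U by (intro ip_Cauchy_Schwarz) auto
    also have "\<dots> \<le> R * L2_norm \<mu> U" using R \<open>t \<in> {0..T}\<close> by (intro mult_right_mono L2_norm_nonneg) auto
    finally show "norm (?G t) \<le> R * L2_norm \<mu> U" by simp
  qed (use int in \<open>auto simp: integrable_on_def\<close>)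
  note abs = this
  have eq: "(\<lambda>t. indicator {0..} t *\<^sub>R ?G t) = (\<lambda>t. indicator {0..T} t *\<^sub>R ?G t)"
    using G0 by (auto simp: indicator_def fun_eq_iff)
  show "set_integrable lebesgue {0..} ?G"
    using abs by (simp only: set_integrable_def eq)
  have "(LINT t:{0..}|lebesgue. ?G t) = (LINT t:{0..T}|lebesgue. ?G t)"
    by (simp only: set_lebesgue_integral_def eq)
  also have "\<dots> = - pairing \<phi> U 0"
    using set_lebesgue_integral_eq_integral(2)[OF abs] int by (simp add: integral_unique)
  finally show "(LINT t:{0..}|lebesgue. ?G t) = - pairing \<phi> U 0" .
qed

end

section \<open>Uniqueness of the monotone transport map\<close>

lemma AE_superset_of_equal_measure:
  assumes fin: "finite_measure M" and sets: "S \<in> sets M" "T \<in> sets M"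
    and sub: "AE m in M. m \<in> S \<longrightarrow> m \<in> T" and eq: "measure M S = measure M T"
  shows "AE m in M. m \<in> T \<longrightarrow> m \<in> S"
proof -
  interpret finite_measure M by (rule fin)
  have "measure M (T \<inter> S) = measure M S"
    by (rule measure_eq_AE) (use sub sets in auto)
  then have "measure M (T - S) = 0"
    using finite_measure_Diff'[OF sets(2,1)] eq by simp
  then have "T - S \<in> null_sets M"
    using sets by (auto simp: null_sets_def emeasure_eq_measure)
  from AE_not_in[OF this] show ?thesis by eventually_elim auto
qed

text \<open>
  The super-level sets of two monotone maps are nested, and equal in measure if the maps
  have the same image measure; so they agree up to null sets.
\<close>
lemma monotone_map_unique:
  assumes fin: "finite_measure \<mu>"
    and X [measurable]: "X \<in> borel_measurable \<mu>" and Z [measurable]: "Z \<in> borel_measurable \<mu>"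
    and mono: "mono_AE \<mu> X" "mono_AE \<mu> Z" and distr: "distr \<mu> borel X = distr \<mu> borel Z"
  shows "AE m in \<mu>. X m = Z m"
proof -
  obtain A where A: "AE m in \<mu>. m \<in> A" "mono_on A X" "mono_on A Z"
    using mono_on_common[OF mono] .
  have "AE m in \<mu>. q < X m \<longleftrightarrow> q < Z m" for q
  proof -
    let ?S = "\<lambda>W. {m \<in> space \<mu>. q < W m}"
    have "measure \<mu> (?S W) = measure (distr \<mu> borel W) {q<..}" if "W \<in> borel_measurable \<mu>" for W
      using that by (subst measure_distr) (auto intro!: arg_cong[where f = "measure \<mu>"])
    then have eq: "measure \<mu> (?S X) = measure \<mu> (?S Z)" by (simp add: distr)
    have sets: "?S X \<in> sets \<mu>" "?S Z \<in> sets \<mu>" by measurable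
    have *: "AE m in \<mu>. q < W m \<longleftrightarrow> q < W' m"
      if sub: "\<forall>m\<in>A. q < W m \<longrightarrow> q < W' m" and S: "?S W \<in> sets \<mu>" "?S W' \<in> sets \<mu>"
        and eq: "measure \<mu> (?S W) = measure \<mu> (?S W')" for W W'
    proof -
      have le: "AE m in \<mu>. m \<in> ?S W \<longrightarrow> m \<in> ?S W'"
        using A(1) by (rule eventually_mono) (use sub in auto)
      from AE_superset_of_equal_measure[OF fin S this eq] le AE_space
      show ?thesis by eventually_elim auto
    qed
    \<comment> \<open>Both super-level sets are upper sets of \<open>A\<close>, hence one contains the other.\<close>
    have "(\<forall>m\<in>A. q < X m \<longrightarrow> q < Z m) \<or> (\<forall>m\<in>A. q < Z m \<longrightarrow> q < X m)"
    proof (rule ccontr)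
      assume "\<not> ?thesis"
      then obtain m m' where m: "m \<in> A" "m' \<in> A" "q < X m" "\<not> q < Z m" "q < Z m'" "\<not> q < X m'"
        by blast
      then have "X m' < X m" "Z m < Z m'" by auto
      then show False
        using mono_on_less[OF A(2), of m' m] mono_on_less[OF A(3), of m m'] m by auto
    qed
    then show ?thesis
    proof
      assume "\<forall>m\<in>A. q < X m \<longrightarrow> q < Z m"
      from *[OF this sets eq] show ?thesis .
    next
      assume "\<forall>m\<in>A. q < Z m \<longrightarrow> q < X m"
      from *[OF this sets(2,1) eq[symmetric]] show ?thesis by eventually_elim simp
    qed
  qed
  then have "AE m in \<mu>. \<forall>q\<in>\<rat>. q < X m \<longleftrightarrow> q < Z m"
    by (intro AE_ball_countable' countable_rat)
  then show ?thesis
  proof eventually_elim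
    case (elim m)
    have "\<not> X m < Z m" "\<not> Z m < X m"
      using elim Rats_dense_in_real[of "X m" "Z m"] Rats_dense_in_real[of "Z m" "X m"]
      by (meson less_asym)+
    then show ?case by simp
  qed
qed

section \<open>The pressureless gas dynamics equations\<close>

lemma has_L2_derivative_reflect:
  assumes "has_L2_derivative M (\<lambda>t. X (- t)) W (- t)"
  shows "has_L2_derivative M X (\<lambda>m. - W m) t"
proof -
  let ?E = "\<lambda>h. L2_norm M (\<lambda>m. (X (- (- t + h)) m - X (- (- t)) m) / h - W m)"
  have "(?E \<longlongrightarrow> 0) (at 0)" using assms by (simp add: has_L2_derivative_def)
  moreover have "filterlim uminus (at (0 :: real)) (at 0)"
    using tendsto_minus[OF tendsto_ident_at[of "0 :: real" UNIV]]
    by (auto simp: filterlim_at eventually_at_filter)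
  ultimately have "((\<lambda>h. ?E (- h)) \<longlongrightarrow> 0) (at 0)" by (rule filterlim_compose)
  moreover have "?E (- h) = L2_norm M (\<lambda>m. (X (t + h) m - X t m) / h - - W m)" for h
  proof -
    have "(\<lambda>m. (X (- (- t + - h)) m - X (- (- t)) m) / - h - W m)
        = (\<lambda>m. - 1 * ((X (t + h) m - X t m) / h - - W m))"
      by (simp add: fun_eq_iff add.commute)
    then show ?thesis by (simp only: L2_norm_scale)
  qed
  ultimately show ?thesis
    using assms L2_uminus by (auto simp: has_L2_derivative_def)
qed

context projected_flow
begin

text \<open>
  Both equations have the form of a transport equation for a quantity \<open>w\<close>, with \<open>w = 1\<close> for mass and
  \<open>w = v\<close> for momentum. The hypothesis \<open>ip_w\<close> says that the Lagrangian quantity at time \<open>t\<close> is the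
  conditional expectation of its initial value.
\<close>
lemma weak_transport_flow:
  assumes \<rho>: "\<And>t. \<rho> t = distr \<mu> borel (X t)"
    and w [measurable]: "\<And>t. w t \<in> borel_measurable borel" "w0 \<in> borel_measurable borel"
    and wL2: "\<And>t. (\<lambda>m. w t (X t m)) \<in> L2 \<mu>" "(\<lambda>m. w0 (X0 m)) \<in> L2 \<mu>"
    and ip_w: "\<And>t f. f \<in> flow_range t \<Longrightarrow> ip \<mu> f (\<lambda>m. w t (X t m)) = ip \<mu> f (\<lambda>m. w0 (X0 m))"
  shows "weak_transport \<rho> v w (distr \<mu> borel X0) w0"
  unfolding weak_transport_def
proof (intro ballI conjI)
  fix \<phi> assume \<phi>: "\<phi> \<in> test_functions"
  let ?U = "\<lambda>m. w0 (X0 m)"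
  let ?I = "\<lambda>t x. (deriv_t \<phi> t x + v t x * deriv_x \<phi> t x) * w t x"
  have I: "integrable (\<rho> t) (?I t)" "(\<integral>x. ?I t x \<partial>\<rho> t) = ip \<mu> (material_derivative \<phi> t) ?U" if t: "0 \<le> t" for t
  proof -
    note [measurable] = test_function_Borel[OF \<phi> t]
    note r = material_derivative_flow_range[OF \<phi> t]
    have "material_derivative \<phi> t \<in> L2 \<mu>" using r by (simp add: flow_range_def)
    then have "integrable \<mu> (\<lambda>m. material_derivative \<phi> t m * w t (X t m))"
      by (rule L2_mult_integrable[OF _ wL2(1)])
    then show "integrable (\<rho> t) (?I t)"
      unfolding \<rho> by (subst integrable_distr_eq) (simp_all add: material_derivative_def V_def)
    have "(\<integral>x. ?I t x \<partial>\<rho> t) = ip \<mu> (material_derivative \<phi> t) (\<lambda>m. w t (X t m))"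
      unfolding \<rho> by (subst integral_distr) (simp_all add: material_derivative_def V_def ip_def)
    then show "(\<integral>x. ?I t x \<partial>\<rho> t) = ip \<mu> (material_derivative \<phi> t) ?U" by (simp add: ip_w[OF r])
  qed
  show "AE t in lebesgue. 0 \<le> t \<longrightarrow> integrable (\<rho> t) (?I t)" using I(1) by simp
  show "set_integrable lebesgue {0..} (\<lambda>t. \<integral>x. ?I t x \<partial>\<rho> t)"
    by (rule iffD2[OF set_integrable_cong[OF refl refl I(2)] material_derivative_integral(1)[OF \<phi> wL2(2)]]) simp
  have "(LINT t:{0..}|lebesgue. (\<integral>x. ?I t x \<partial>\<rho> t)) = (LINT t:{0..}|lebesgue. ip \<mu> (material_derivative \<phi> t) ?U)"
    by (rule set_lebesgue_integral_cong) (use I(2) in auto)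
  also have "\<dots> = - pairing \<phi> ?U 0" by (rule material_derivative_integral(2)[OF \<phi> wL2(2)])
  also have "pairing \<phi> ?U 0 = (\<integral>x. \<phi> (0, x) * w0 x \<partial>distr \<mu> borel X0)"
  proof -
    have B [measurable]: "(\<lambda>x. \<phi> (0, x)) \<in> borel_measurable borel"
      by (rule test_function_Borel(1)[OF \<phi>]) simp
    note [measurable] = measurable_compose[OF L2_measurable[OF X_L2] B]
      measurable_compose[OF L2_measurable[OF X0_L2] B]
    have "pairing \<phi> ?U 0 = ip \<mu> (\<lambda>m. \<phi> (0, X0 m)) ?U"
      unfolding pairing_def using X_initial by (intro ip_cong_AE) auto
    also have "\<dots> = (\<integral>x. \<phi> (0, x) * w0 x \<partial>distr \<mu> borel X0)"
      by (subst integral_distr) (simp_all add: ip_def)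
    finally show ?thesis .
  qed
  finally show "- (\<integral>x. \<phi> (0, x) * w0 x \<partial>distr \<mu> borel X0) =
      (LINT t:{0..}|lebesgue. (\<integral>x. ?I t x \<partial>\<rho> t))" by simp
qed

end

lemma countable_imp_AE_lebesgue:
  assumes "countable (N :: real set)"
  shows "AE t in lebesgue. t \<notin> N"
  using countable_imp_null_set_lborel[OF assms] by (intro AE_not_in null_sets_completionI)

theorem theorem3p3:
  fixes \<rho>0 \<mu> :: "real measure" and v0 X0 V0 :: "real \<Rightarrow> real"
    and X :: "real \<Rightarrow> real \<Rightarrow> real" and \<rho> :: "real \<Rightarrow> real measure"
  assumes "\<rho>0 \<in> P2" and "v0 \<in> L2 \<rho>0"
    and "\<mu> \<in> P2"
    and "X0 \<in> monotone_maps \<mu>" and "distr \<mu> borel X0 = \<rho>0"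
    and "V0 = v0 \<circ> X0"
    and "\<And>t. X t = proj_monotone \<mu> (\<lambda>m. X0 m + t * V0 m)"
    and "\<And>t. \<rho> t = distr \<mu> borel (X t)"
  shows "(\<forall>X'\<in>monotone_maps \<mu>. distr \<mu> borel X' = \<rho>0 \<longrightarrow> (AE m in \<mu>. X' m = X0 m)) \<and>
    (\<exists>V v.
       (AE t in lebesgue. has_L2_derivative \<mu> X (V t) t) \<and>
       (AE t in lebesgue. v t \<in> L2 (\<rho> t) \<and> (AE m in \<mu>. V t m = v t (X t m))) \<and>
       pressureless_weak_solution \<rho> v \<rho>0 v0)"
proof
  have \<mu>: "sets \<mu> = sets borel" and "prob_space \<mu>" using assms(3) by (auto simp: P2_def)
  then have fin: "finite_measure \<mu>" by (simp add: prob_space_def)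
  have X0_L2: "X0 \<in> L2 \<mu>" and X0_mono: "mono_AE \<mu> X0"
    using assms(4) \<mu> by (auto simp: monotone_maps_iff)
  note [measurable] = L2_measurable[OF X0_L2]
  show "\<forall>X'\<in>monotone_maps \<mu>. distr \<mu> borel X' = \<rho>0 \<longrightarrow> (AE m in \<mu>. X' m = X0 m)"
    using monotone_map_unique[OF fin _ L2_measurable[OF X0_L2] _ X0_mono] assms(5) \<mu>
    by (auto simp: monotone_maps_iff L2_measurable)
  have v0: "v0 \<in> borel_measurable borel"
    using L2_measurable[OF assms(2)] by (simp add: assms(5)[symmetric])
  have V0: "V0 = (\<lambda>m. v0 (X0 m))" by (simp add: assms(6) fun_eq_iff)
  have V0_L2: "V0 \<in> L2 \<mu>"
    using assms(2) L2_distr[OF _ v0, of X0 \<mu>] by (simp add: V0 assms(5)[symmetric])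
  have closest_X: "closest \<mu> (monotone_maps \<mu>) (\<lambda>m. X0 m + t * V0 m) (X t)" for t
    unfolding assms(7) by (intro closest_proj_monotone \<mu> fin L2_add L2_scale X0_L2 V0_L2)
  then have X_meas: "X t \<in> borel_measurable \<mu>" for t
    by (auto simp: closest_def intro!: L2_measurable monotone_maps_L2)
  have "\<exists>w. is_cexp \<mu> (X t) V0 w" for t by (rule is_cexp_exists[OF fin X_meas V0_L2])
  then obtain v where v: "\<And>t. is_cexp \<mu> (X t) V0 (v t)" by metis
  interpret F: projected_flow \<mu> X0 V0 X v
    by (rule projected_flow.intro) (rule \<mu> fin assms(4) V0_L2 closest_X v)+
  \<comment> \<open>Negative times are covered by running the flow with the opposite initial velocity.\<close>
  interpret B: projected_flow \<mu> X0 "\<lambda>m. - V0 m" "\<lambda>t. X (- t)" "\<lambda>t x. - v (- t) x"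
  proof (rule projected_flow.intro)
    show "closest \<mu> (monotone_maps \<mu>) (\<lambda>m. X0 m + t * - V0 m) (X (- t))" for t
      using closest_X[of "- t"] by simp
    show "is_cexp \<mu> (X (- t)) (\<lambda>m. - V0 m) (\<lambda>x. - v (- t) x)" for t
      by (rule is_cexp_uminus[OF v V0_L2])
  qed (rule \<mu> fin assms(4) L2_uminus[OF V0_L2])+
  define N where "N = {t. 0 < t \<and> \<not> has_L2_derivative \<mu> X (F.V t) t}"
  define N' where "N' = {t. 0 < t \<and> \<not> has_L2_derivative \<mu> (\<lambda>t. X (- t)) (B.V t) t}"
  have "countable (insert 0 (N \<union> uminus ` N'))"
    using F.has_derivative_countable B.has_derivative_countable by (simp add: N_def N'_def)
  then have "AE t in lebesgue. t \<notin> insert 0 (N \<union> uminus ` N')"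
    by (rule countable_imp_AE_lebesgue)
  then have deriv: "AE t in lebesgue. has_L2_derivative \<mu> X (F.V t) t"
  proof eventually_elim
    case (elim t)
    show ?case
    proof (cases "0 < t")
      case True
      then show ?thesis using elim by (auto simp: N_def)
    next
      case False
      then have "0 < - t" using elim by auto
      moreover have "- t \<notin> N'"
      proof
        assume "- t \<in> N'"
        then have "- (- t) \<in> uminus ` N'" by (rule imageI)
        then show False using elim by simp
      qed
      ultimately have "has_L2_derivative \<mu> (\<lambda>t. X (- t)) (B.V (- t)) (- t)" by (auto simp: N'_def)
      from has_L2_derivative_reflect[OF this] show ?thesis
        by (simp add: B.V_def F.V_def[abs_def])
    qed
  qed
  have "pressureless_weak_solution \<rho> v \<rho>0 v0"
    unfolding pressureless_weak_solution_def assms(5)[symmetric]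
  proof
    have one: "(\<lambda>m. 1) \<in> L2 \<mu>" by (rule L2_const[OF fin])
    show "weak_transport \<rho> v (\<lambda>t x. 1) (distr \<mu> borel X0) (\<lambda>x. 1)"
      by (rule F.weak_transport_flow) (use assms(8) one in auto)
    show "weak_transport \<rho> v v (distr \<mu> borel X0) v0"
    proof (rule F.weak_transport_flow)
      show "(\<lambda>m. v0 (X0 m)) \<in> L2 \<mu>" using V0_L2 by (simp add: V0)
      show "(\<lambda>m. v t (X t m)) \<in> L2 \<mu>" for t by (rule is_cexp_L2[OF v])
      show "ip \<mu> f (\<lambda>m. v t (X t m)) = ip \<mu> f (\<lambda>m. v0 (X0 m))" if "f \<in> F.flow_range t" for f t
        using F.ip_V0_eq[OF that] by (simp add: ip_commute[of \<mu> f] V0 F.V_def[abs_def])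
    qed (use assms(8) v0 is_cexp_measurable[OF v] in auto)
  qed
  moreover have "v t \<in> L2 (\<rho> t) \<and> (AE m in \<mu>. F.V t m = v t (X t m))" for t
    using L2_distr[OF X_meas is_cexp_measurable[OF v]] is_cexp_L2[OF v]
    by (simp add: assms(8) F.V_def)
  ultimately show "\<exists>V v.
       (AE t in lebesgue. has_L2_derivative \<mu> X (V t) t) \<and>
       (AE t in lebesgue. v t \<in> L2 (\<rho> t) \<and> (AE m in \<mu>. V t m = v t (X t m))) \<and>
       pressureless_weak_solution \<rho> v \<rho>0 v0"
    using deriv by (intro exI[of _ F.V] exI[of _ v]) simp
qed

end
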